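(* Let $n\ge1$ and let $\lambda$ be a partition with $l(\lambda)\le 2n$, regarded as a vector $(\lambda_1,\dots,\lambda_{2n})$ with $2n$ parts (zeros allowed). Let $\alpha\in\mathbb{C}$. Then $$\frac{1-\alpha^2}{\int_T\tilde\Delta_K^{(n-1)}(x;t,-t,\sqrt t,-\sqrt t;t)\,dT}\int_T P_\lambda(x_1^{\pm1},\dots,x_{n-1}^{\pm1},1,-1;t)\,\tilde\Delta_K^{(n-1)}(x;t,-t,\sqrt t,-\sqrt t;t)\prod_{i=1}^{n-1}(1-\alpha x_i^{\pm1})\,dT$$ $$=\frac{\phi_{2n}(t)}{v_\lambda(t)(1-t)^{2n}}\Big[(-\alpha)^{\#\text{ of odd parts of }\lambda}-(-\alpha)^{\#\text{ of even parts of }\lambda}\Big].$$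
   Context: Let $t\in\mathbb{C}$ with $|t|<1$ and fix a square root $\sqrt t$. $T=\{(x_1,\dots,x_k):|x_1|=\dots=|x_k|=1\}$ is the torus in the variables of integration, $dT=\prod_j \frac{dx_j}{2\pi\sqrt{-1}\,x_j}$ (when there are no variables, the integral is evaluation). $[i]=(1-t^i)/(1-t)$, $[m]!=[m][m-1]\cdots[1]$, $[0]!=1$; $\phi_r(t)=(1-t)(1-t^2)\cdots(1-t^r)$. For a partition $\lambda$ with $N$ parts (zeros included), $m_i(\lambda)$ is the number of $j\in\{1,\dots,N\}$ with $\lambda_j=i$, and $v_\lambda(t)=\prod_{i\ge0}[m_i(\lambda)]!$ (zero parts are counted). The Hall--Littlewood polynomial in $N$ variables is $P_\lambda(z_1,\dots,z_N;t)=\frac{1}{v_\lambda(t)}\sum_{w\in S_N}w\Big(z^\lambda\prod_{1\le i<j\le N}\frac{z_i-tz_j}{z_i-z_j}\Big)$, with $w$ permuting the subscripts of the variables. $P_\lambda(x_1^{\pm1},\dots,x_{n-1}^{\pm1},1,-1;t)$ is its value at the $2n$ arguments $x_1,x_1^{-1},\dots,x_{n-1},x_{n-1}^{-1},1,-1$. The symmetric Koornwinder density is $$\tilde\Delta_K^{(k)}(x;a,b,c,d;t)=\frac{1}{2^kk!}\prod_{1\le i\le k}\frac{1-x_i^{\pm2}}{(1-ax_i^{\pm1})(1-bx_i^{\pm1})(1-cx_i^{\pm1})(1-dx_i^{\pm1})}\prod_{1\le i<j\le k}\frac{1-x_i^{\pm1}x_j^{\pm1}}{1-tx_i^{\pm1}x_j^{\pm1}},$$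 where an expression with $\pm$ signs denotes the product over all choices of signs, e.g. $1-x_i^{\pm2}$ means $(1-x_i^2)(1-x_i^{-2})$, $1-\alpha x_i^{\pm1}$ means $(1-\alpha x_i)(1-\alpha x_i^{-1})$, and $1-x_i^{\pm1}x_j^{\pm1}$ is a product of four factors. The numbers of odd and even parts of $\lambda$ are counted among all $2n$ entries, a zero entry being an even part. *)

theory Defs
  imports "HOL-Analysis.Analysis" "HOL-Combinatorics.Permutations"
begin

text \<open>
  A partition with \<open>N\<close> parts (zeros allowed) is a weakly decreasing \<open>nat list\<close> of length \<open>N\<close>.
  Variables \<open>z\<^sub>1, \<dots>, z\<^sub>N\<close> are \<open>z 0, \<dots>, z (N - 1)\<close> for \<open>z :: nat \<Rightarrow> complex\<close>.
\<close>

definition is_partition :: "nat list \<Rightarrow> bool" where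
  "is_partition lam \<longleftrightarrow> sorted_wrt (\<ge>) lam"

definition t_num :: "complex \<Rightarrow> nat \<Rightarrow> complex" where
  "t_num t i = (1 - t ^ i) / (1 - t)"

definition t_fact :: "complex \<Rightarrow> nat \<Rightarrow> complex" where
  "t_fact t m = (\<Prod>i=1..m. t_num t i)"

definition phi :: "nat \<Rightarrow> complex \<Rightarrow> complex" where
  "phi r t = (\<Prod>i=1..r. 1 - t ^ i)"

text \<open>Values \<open>i\<close> that do not occur in \<open>lam\<close> contribute the factor \<open>[0]! = 1\<close>.\<close>

definition v_part :: "nat list \<Rightarrow> complex \<Rightarrow> complex" where
  "v_part lam t = (\<Prod>i\<in>set lam. t_fact t (count_list lam i))"

definition hl_expr :: "nat list \<Rightarrow> complex \<Rightarrow> (nat \<Rightarrow> complex) \<Rightarrow> complex" where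
  "hl_expr lam t z = 1 / v_part lam t *
     (\<Sum>w | w permutes {..<length lam}.
        (\<Prod>i<length lam. z (w i) ^ (lam ! i)) *
        (\<Prod>(i, j)\<in>{(i, j). i < j \<and> j < length lam}. (z (w i) - t * z (w j)) / (z (w i) - z (w j))))"

text \<open>
  \<open>hl_expr\<close> is the defining rational expression of the Hall--Littlewood polynomial; the denominators
  cancel in the sum over \<open>w\<close>. At points with coinciding variables, where the
  individual summands are undefined, the value of the polynomial is the limit of the expression
  along points with pairwise distinct variables. At the latter points the limit is the
  expression itself (lemma \<open>hall_littlewood_distinct\<close>).
\<close>

definition hall_littlewood :: "nat list \<Rightarrow> complex \<Rightarrow> (nat \<Rightarrow> complex) \<Rightarrow> complex" where
  "hall_littlewood lam t z =
     Lim (at z within {y. inj_on y {..<length lam}}) (hl_expr lam t)"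

text \<open>The arguments \<open>x\<^sub>1, x\<^sub>1\<^sup>-\<^sup>1, \<dots>, x\<^sub>k, x\<^sub>k\<^sup>-\<^sup>1, 1, -1\<close>.\<close>

definition pm_args :: "nat \<Rightarrow> (nat \<Rightarrow> complex) \<Rightarrow> nat \<Rightarrow> complex" where
  "pm_args k x m =
     (if m < 2 * k then (if even m then x (m div 2) else inverse (x (m div 2)))
      else if m = 2 * k then 1 else -1)"

text \<open>\<open>one_minus_pm \<alpha> y\<close> is \<open>1 - \<alpha>y\<^sup>\<plusminus>\<^sup>1\<close> and \<open>one_minus_pm2 \<alpha> y z\<close> is \<open>1 - \<alpha>y\<^sup>\<plusminus>\<^sup>1z\<^sup>\<plusminus>\<^sup>1\<close>.\<close>

definition one_minus_pm :: "complex \<Rightarrow> complex \<Rightarrow> complex" where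
  "one_minus_pm \<alpha> y = (1 - \<alpha> * y) * (1 - \<alpha> * inverse y)"

definition one_minus_pm2 :: "complex \<Rightarrow> complex \<Rightarrow> complex \<Rightarrow> complex" where
  "one_minus_pm2 \<alpha> y z =
     (1 - \<alpha> * y * z) * (1 - \<alpha> * y * inverse z) *
     (1 - \<alpha> * inverse y * z) * (1 - \<alpha> * inverse y * inverse z)"

definition koornwinder_density ::
    "nat \<Rightarrow> (nat \<Rightarrow> complex) \<Rightarrow> complex \<Rightarrow> complex \<Rightarrow> complex \<Rightarrow> complex \<Rightarrow> complex \<Rightarrow> complex" where
  "koornwinder_density k x a b c d t =
     1 / (2 ^ k * fact k) *
     (\<Prod>i<k. one_minus_pm 1 ((x i)\<^sup>2) /
        (one_minus_pm a (x i) * one_minus_pm b (x i) * one_minus_pm c (x i) * one_minus_pm d (x i))) *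
     (\<Prod>(i, j)\<in>{(i, j). i < j \<and> j < k}. one_minus_pm2 1 (x i) (x j) / one_minus_pm2 t (x i) (x j))"

text \<open>
  Under \<open>x = exp (2 \<pi> \<i> \<theta>)\<close> with \<open>0 \<le> \<theta> \<le> 1\<close>, the form \<open>dx / (2 \<pi> \<i> x)\<close> on the positively
  oriented unit circle becomes \<open>d\<theta>\<close>. For \<open>k = 0\<close> the product measure below is a point
  mass, so the integral is evaluation.
\<close>

definition circle_measure :: "complex measure" where
  "circle_measure = distr (restrict_space lborel {0..1}) borel (\<lambda>\<theta>::real. cis (2 * pi * \<theta>))"

definition torus_integral :: "nat \<Rightarrow> ((nat \<Rightarrow> complex) \<Rightarrow> complex) \<Rightarrow> complex" where
  "torus_integral k f = (\<integral>x. f x \<partial>(\<Pi>\<^sub>M i\<in>{..<k}. circle_measure))"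

lemma hall_littlewood_distinct:
  assumes z: "inj_on z {..<length lam}"
  shows "hall_littlewood lam t z = hl_expr lam t z"
proof -
  let ?N = "length lam" and ?D = "{y::nat \<Rightarrow> complex. inj_on y {..<length lam}}"
  have co: "((\<lambda>y::nat \<Rightarrow> complex. y i) \<longlongrightarrow> z i) (at z within ?D)" for i
  proof -
    have "continuous_on UNIV (\<lambda>y::nat \<Rightarrow> complex. y i)"
      by (rule continuous_on_product_coordinates)
    then show ?thesis
      by (auto simp: continuous_on_def intro: tendsto_within_subset)
  qed
  have quot: "((\<lambda>y. (y (w i) - t * y (w j)) / (y (w i) - y (w j))) \<longlongrightarrow>
      (z (w i) - t * z (w j)) / (z (w i) - z (w j))) (at z within ?D)"
    if w: "w permutes {..<?N}" and ij: "i < j" "j < ?N" for w i j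
  proof -
    have "w i \<in> {..<?N}" "w j \<in> {..<?N}"
      using w ij permutes_in_image[of w "{..<?N}"] by auto
    moreover have "w i \<noteq> w j"
      using w ij permutes_inj[of w "{..<?N}"] by (auto dest: injD)
    ultimately have "z (w i) - z (w j) \<noteq> 0"
      using z by (auto dest: inj_onD)
    then show ?thesis by (intro tendsto_intros co)
  qed
  have "(hl_expr lam t \<longlongrightarrow> hl_expr lam t z) (at z within ?D)"
    unfolding hl_expr_def
    by (intro tendsto_mult[OF tendsto_const] tendsto_sum tendsto_mult tendsto_prod tendsto_power co)
       (auto intro: quot)
  moreover have "at z within ?D \<noteq> bot"
  proof -
    let ?g = "\<lambda>c::complex. \<lambda>i. z i + c"
    have "continuous_on UNIV ?g"
      by (rule continuous_on_coordinatewise_then_product) (intro continuous_intros)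
    then have "(?g \<longlongrightarrow> ?g 0) (at 0)"
      unfolding continuous_on_def by blast
    then have "filterlim ?g (at z within ?D) (at 0)"
      using z by (auto simp: filterlim_at eventually_at_filter fun_eq_iff inj_on_def)
    then show ?thesis
      by (metis filterlim_def filtermap_bot_iff bot.extremum_uniqueI at_neq_bot)
  qed
  ultimately show ?thesis
    unfolding hall_littlewood_def by (intro tendsto_Lim)
qed

end

theory Submission
  imports Defs "HOL-Complex_Analysis.Complex_Analysis" "HOL-Probability.Probability"
    "HOL-Combinatorics.Multiset_Permutations"
begin

text \<open>
  The factor \<open>(1 - \<alpha>\<^sup>2) \<Prod>(1 - \<alpha>x\<^sub>i\<^sup>\<plusminus>\<^sup>1)\<close> is the product of \<open>1 - \<alpha>z\<close> over the \<open>2n\<close> arguments \<open>z\<close> of the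
  Hall--Littlewood polynomial. This product is symmetric, so it may be moved into the
  symmetrisation: with \<open>g\<^sub>l(z) = z\<^sup>l (1 - \<alpha>z)\<close>, what has to be integrated is the sum \<open>R\<close> over all orderings
  \<open>z\<^sub>1, z\<^sub>2, \<dots>\<close> of the arguments of \<open>\<Prod> g\<close> (part \<open>\<lambda>\<^sub>i\<close> at \<open>z\<^sub>i\<close>) times \<open>\<Prod>\<^sub>i\<^sub><\<^sub>j (z\<^sub>i - t z\<^sub>j) / (z\<^sub>i - z\<^sub>j)\<close>.

  The integral is computed by splitting \<open>R\<close> according to the first argument (\<open>letter\<close>) of the ordering. For
  this it is embedded into a family: the letters are \<open>x\<^sub>i, x\<^sub>i\<^sup>-\<^sup>1\<close> for \<open>i \<in> K\<close> together with a set
  \<open>F \<subseteq> {1, -1}\<close> of fixed letters, and the density is multiplied by one and the same factor \<open>\<theta>(x\<^sub>i, f)\<close> for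
  each fixed letter \<open>f\<close>. The Koornwinder density with parameters \<open>t, -t, \<surd>t, -\<surd>t\<close> is the case
  \<open>F = {1, -1}\<close>.

  If the first letter is \<open>c \<in> F\<close>, its factors cancel the \<open>\<theta>(x\<^sub>i, c)\<close>, and the integral for \<open>F - {c}\<close> and
  the remaining parts appears. If it is \<open>y = x\<^sub>j\<close> or \<open>y = x\<^sub>j\<^sup>-\<^sup>1\<close>, half of the \<open>y\<close>-dependent factors
  cancel and the two cases together give \<open>D(y) + D(y\<^sup>-\<^sup>1)\<close> with \<open>D(y) = E(y) / (y\<^sup>2 - 1)\<close> (lemma
  \<open>letter_term_variable\<close>). Here \<open>E(y)\<close> is \<open>y\<^sup>l\<^sup>+\<^sup>2\<close> times the value of \<open>R\<close> for the remaining parts, which depends on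
  \<open>y\<close> only through the letter \<open>y\<^sup>-\<^sup>1\<close> and is a polynomial of degree at most \<open>l + 1\<close> in it, because
  \<open>l\<close> is the largest part; all other factors are regular for \<open>\<bar>y\<bar> \<le> 1\<close>. So \<open>E\<close> is holomorphic on a disc
  of radius greater than \<open>1\<close> and \<open>E(0) = 0\<close>, and then the mean value property gives
  \<open>(E(1) + E(-1)) / 2\<close> for the integral over \<open>y\<close> (lemma \<open>circle_integral_symmetrized\<close>).
  Finally \<open>E(c)\<close> vanishes if \<open>c \<in> F\<close>, and otherwise it is, up to a constant, the integrand with \<open>x\<^sub>j\<close> removed and
  \<open>c\<close> added to \<open>F\<close>.

  The result is a recursion on the parts (lemma \<open>hl_integral_Cons\<close>) that closes up among the
  four sets \<open>F\<close> and sees a part \<open>l\<close> only through \<open>g\<^sub>l(1)\<close> and \<open>g\<^sub>l(-1)\<close>, that is, through its parity. Its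
  solution is lemma \<open>hl_integral_value\<close>. The case \<open>\<alpha> = 0\<close>, \<open>\<lambda> = 0\<close>, in which \<open>R\<close> is the
  constant \<open>[2n]!\<close>, evaluates the normalising integral and shows that it is not zero.

  The summands of \<open>R\<close> are singular where letters coincide, so every use of Fubini's theorem needs to know
  that \<open>R\<close> itself is bounded. In one letter \<open>R\<close> is a polynomial because its simple poles cancel in pairs
  (lemma \<open>hl_sum_insert_poly\<close>); interpolation in one letter after the other turns this into a
  polynomial in all of them (lemma \<open>hl_sum_polyf\<close>). The same fact shows that the limit defining
  \<open>hall_littlewood\<close> exists everywhere and is measurable.
\<close>

section \<open>Polynomials with prescribed zeros and values\<close>

lemma prod_linear_factors_dvd:
  fixes p :: "'a::idom poly"
  assumes "finite A" "\<And>a. a \<in> A \<Longrightarrow> poly p a = 0"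
  shows "(\<Prod>a\<in>A. [:-a, 1:]) dvd p"
  using assms
proof (induction A arbitrary: p rule: finite_induct)
  case (insert a A)
  obtain q where q: "p = [:-a, 1:] * q"
    using insert.prems[of a] by (auto simp: poly_eq_0_iff_dvd elim: dvdE)
  have "poly q b = 0" if "b \<in> A" for b
    using insert.prems[of b] insert.hyps that by (auto simp: q)
  from insert.IH[OF this] have "(\<Prod>a\<in>A. [:-a, 1:]) dvd q" by blast
  then show ?case using insert.hyps by (auto simp: q simp del: mult_pCons_left)
qed simp

lemma lagrange_interpolation:
  fixes p :: "'a::field poly"
  assumes A: "finite A" "degree p < card A"
  shows "poly p y = (\<Sum>a\<in>A. poly p a * (\<Prod>b\<in>A - {a}. (y - b) / (a - b)))"
proof -
  define q where "q = (\<Sum>a\<in>A. smult (poly p a / (\<Prod>b\<in>A - {a}. a - b)) (\<Prod>b\<in>A - {a}. [:-b, 1:]))"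
  have q: "poly q y = (\<Sum>a\<in>A. poly p a * (\<Prod>b\<in>A - {a}. (y - b) / (a - b)))" for y
    by (simp add: q_def poly_sum poly_prod prod_dividef)
  have "degree (\<Prod>b\<in>A - {a}. [:-b, 1:]) \<le> card (A - {a})" for a
    using degree_prod_sum_le[of "A - {a}" "\<lambda>b. [:-b, 1:]"] A by simp
  moreover have "card (A - {a}) < card A" if "a \<in> A" for a
    using A(1) that by (rule card_Diff1_less)
  ultimately have "degree (smult c (\<Prod>b\<in>A - {a}. [:-b, 1:])) < card A" if "a \<in> A" for a c
    using that by (meson degree_smult_le le_less_trans)
  then have dq: "degree q < card A"
    unfolding q_def using A by (intro degree_sum_less) auto
  have "poly q a = poly p a" if "a \<in> A" for a
  proof -
    have "(\<Prod>b\<in>A - {c}. (a - b) / (c - b)) = (if c = a then 1 else 0)" if "c \<in> A" for c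
    proof (cases "c = a")
      case True
      then have "(\<Prod>b\<in>A - {c}. (a - b) / (c - b)) = (\<Prod>b\<in>A - {c}. 1)"
        by (intro prod.cong) auto
      then show ?thesis using True by simp
    next
      case False
      then have "a \<in> A - {c}" using \<open>a \<in> A\<close> by auto
      then show ?thesis using A False by (auto intro!: prod_zero bexI[of _ a])
    qed
    then have "poly q a = (\<Sum>c\<in>A. if c = a then poly p c else 0)"
      unfolding q by (intro sum.cong) simp_all
    then show ?thesis using A(1) that by simp
  qed
  then have "p = q"
    by (intro poly_eqI_degree[of A]) (use A dq in simp_all)
  then have "poly p y = poly q y" by simp
  also have "\<dots> = (\<Sum>a\<in>A. poly p a * (\<Prod>b\<in>A - {a}. (y - b) / (a - b)))" by (rule q)
  finally show ?thesis .
qed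

text \<open>
  Lagrange interpolation at the points of \<open>Z\<close> of \<open>\<Prod>(X - tu) - \<Prod>(X - u)\<close>, whose leading terms cancel,
  evaluated at \<open>0\<close>.
\<close>

lemma sum_first_letter:
  fixes Z :: "'a::field set"
  assumes Z: "finite Z" "0 \<notin> Z"
  shows "(1 - t) * (\<Sum>z\<in>Z. \<Prod>u\<in>Z - {z}. (z - t * u) / (z - u)) = 1 - t ^ card Z"
proof (cases "Z = {}")
  case False
  define A B where "A = (\<Prod>u\<in>Z. [:-(t * u), 1:])" and "B = (\<Prod>u\<in>Z. [:-u, 1:])"
  have lA: "lead_coeff A = 1" "degree A = card Z" and lB: "lead_coeff B = 1" "degree B = card Z"
    unfolding A_def B_def by (subst lead_coeff_prod degree_prod_eq_sum_degree; simp)+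
  have d: "degree (A - B) < card Z"
  proof -
    have "degree (A - B) \<le> card Z" using lA lB by (intro degree_diff_le) auto
    moreover have "coeff (A - B) (card Z) = 0" using lA lB by simp
    moreover have "card Z > 0" using False Z by (simp add: card_gt_0_iff)
    ultimately show ?thesis
      by (metis degree_0 leading_coeff_0_iff le_neq_implies_less)
  qed
  define c where "c = (\<Prod>u\<in>Z. - u)"
  have c: "c \<noteq> 0" using Z by (auto simp: c_def)
  have *: "poly (A - B) z * (\<Prod>u\<in>Z - {z}. (0 - u) / (z - u)) =
      - (1 - t) * c * (\<Prod>u\<in>Z - {z}. (z - t * u) / (z - u))" if z: "z \<in> Z" for z
  proof -
    have "poly B z = 0" using Z z by (auto simp: B_def poly_prod)
    moreover have "poly A z = (z - t * z) * (\<Prod>u\<in>Z - {z}. z - t * u)"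
      using Z z using prod.remove[OF Z(1) z, of "\<lambda>u. z - t * u"] by (simp add: A_def poly_prod)
    moreover have "c = - z * (\<Prod>u\<in>Z - {z}. - u)"
      using Z z by (simp add: c_def prod.remove[of Z z])
    ultimately have "poly (A - B) z = (1 - t) * (z * (\<Prod>u\<in>Z - {z}. z - t * u))"
      and c': "c = - z * (\<Prod>u\<in>Z - {z}. - u)"
      by (simp_all add: algebra_simps)
    moreover have "(1 - t) * (z * p) * (m / d) = - (1 - t) * (- z * m) * (p / d)" for p m d :: 'a
    proof -
      have "(1 - t) * (z * p) * m = - (1 - t) * (- z * m) * p" by (simp add: algebra_simps)
      then show ?thesis by simp
    qed
    ultimately show ?thesis unfolding c' prod_dividef by simp
  qed
  have e1: "poly (A - B) 0 = - (1 - t) * c * (\<Sum>z\<in>Z. \<Prod>u\<in>Z - {z}. (z - t * u) / (z - u))"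
    using lagrange_interpolation[OF Z(1) d, of 0] * by (simp add: sum_distrib_left)
  have "(\<Prod>u\<in>Z. - (t * u)) = (\<Prod>u\<in>Z. t * (- u))" by simp
  then have e2: "poly (A - B) 0 = (t ^ card Z - 1) * c"
    by (simp only: prod.distrib) (simp add: A_def B_def poly_prod c_def algebra_simps)
  have "- (1 - t) * c * (\<Sum>z\<in>Z. \<Prod>u\<in>Z - {z}. (z - t * u) / (z - u)) = (t ^ card Z - 1) * c"
    unfolding e1[symmetric] e2 ..
  moreover have "c * ((1 - t) * S) = - (- (1 - t) * c * S)" for S by (simp add: algebra_simps)
  ultimately have "c * ((1 - t) * (\<Sum>z\<in>Z. \<Prod>u\<in>Z - {z}. (z - t * u) / (z - u))) = c * (1 - t ^ card Z)"
    by (simp only:) (simp add: algebra_simps)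
  then show ?thesis using c by simp
qed simp

section \<open>Sums over orderings of the letters\<close>

text \<open>
  \<open>J\<close> indexes the letters and \<open>z\<close> gives their values. Choosing the first letter recursively produces
  the sum over all orderings (lemma \<open>hl_sum_permutations_of_set\<close>) when there are as many parts as letters.
  Indices make the dependence on the values explicit, which measurability needs; taking
  \<open>z\<close> to be the identity on a set of numbers makes the symmetry explicit.
\<close>

fun hl_sum :: "complex \<Rightarrow> complex \<Rightarrow> nat list \<Rightarrow> 'i set \<Rightarrow> ('i \<Rightarrow> complex) \<Rightarrow> complex" where
  "hl_sum t \<alpha> [] J z = 1"
| "hl_sum t \<alpha> (l # ls) J z =
     (\<Sum>a\<in>J. z a ^ l * (1 - \<alpha> * z a) * (\<Prod>b\<in>J - {a}. (z a - t * z b) / (z a - z b)) *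
        hl_sum t \<alpha> ls (J - {a}) z)"

lemma hl_sum_image:
  "inj_on z J \<Longrightarrow> hl_sum t \<alpha> lam (z ` J) (\<lambda>u. u) = hl_sum t \<alpha> lam J z"
proof (induction lam arbitrary: J)
  case (Cons l ls)
  have im: "z ` J - {z a} = z ` (J - {a})" if "a \<in> J" for a
    using that Cons.prems by (auto dest: inj_onD)
  have ij: "inj_on z (J - {a})" for a
    by (rule inj_on_subset[OF Cons.prems]) auto
  show ?case
    by (simp add: sum.reindex[OF Cons.prems] im Cons.IH[OF ij] prod.reindex[OF ij] cong: sum.cong)
qed simp

lemma hl_sum_cong:
  "(\<And>a. a \<in> J \<Longrightarrow> z a = z' a) \<Longrightarrow> hl_sum t \<alpha> lam J z = hl_sum t \<alpha> lam J z'"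
proof (induction lam arbitrary: J)
  case (Cons l ls)
  have "hl_sum t \<alpha> ls (J - {a}) z = hl_sum t \<alpha> ls (J - {a}) z'" for a
    by (rule Cons.IH) (use Cons.prems in auto)
  moreover have "(\<Prod>b\<in>J - {a}. (z a - t * z b) / (z a - z b)) =
     (\<Prod>b\<in>J - {a}. (z' a - t * z' b) / (z' a - z' b))" if "a \<in> J" for a
    using Cons.prems that by (intro prod.cong) auto
  ultimately show ?case using Cons.prems by (auto intro!: sum.cong)
qed simp

text \<open>
  Each choice of a first letter among \<open>m\<close> contributes \<open>[m]\<close> in total (lemma \<open>sum_first_letter\<close>).
\<close>

lemma hl_sum_replicate_0:
  assumes "finite J" "inj_on z J" "\<And>a. a \<in> J \<Longrightarrow> z a \<noteq> 0" "t \<noteq> 1"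
  shows "hl_sum t 0 (replicate (card J) 0) J z = t_fact t (card J)"
  using assms
proof (induction "card J" arbitrary: J)
  case 0
  then show ?case by (simp add: t_fact_def)
next
  case (Suc m)
  have "hl_sum t 0 (replicate (Suc m) 0) J z =
      (\<Sum>a\<in>J. (\<Prod>b\<in>J - {a}. (z a - t * z b) / (z a - z b)) * t_fact t m)"
  proof (simp, intro sum.cong refl arg_cong2[where f="(*)"])
    fix a assume a: "a \<in> J"
    have "m = card (J - {a})" using Suc a by simp
    then show "hl_sum t 0 (replicate m 0) (J - {a}) z = t_fact t m"
      using Suc.hyps(1)[of "J - {a}"] Suc.prems by (auto intro: inj_on_subset)
  qed
  also have "\<dots> = (\<Sum>a\<in>J. \<Prod>b\<in>J - {a}. (z a - t * z b) / (z a - z b)) * t_fact t m"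
    by (simp add: sum_distrib_right)
  also have "(\<Sum>a\<in>J. \<Prod>b\<in>J - {a}. (z a - t * z b) / (z a - z b)) =
      (\<Sum>v\<in>z ` J. \<Prod>u\<in>z ` J - {v}. (v - t * u) / (v - u))"
  proof -
    have "z ` J - {z a} = z ` (J - {a})" if "a \<in> J" for a
      using that Suc.prems by (auto dest: inj_onD)
    moreover have "inj_on z (J - {a})" for a
      by (rule inj_on_subset[OF Suc.prems(2)]) auto
    ultimately show ?thesis
      by (simp add: sum.reindex[OF Suc.prems(2)] prod.reindex cong: sum.cong)
  qed
  also have "\<dots> = t_num t (Suc m)"
    using sum_first_letter[of "z ` J" t] Suc.prems Suc.hyps(2)
    by (simp add: t_num_def card_image eq_divide_eq mult.commute image_iff)
  finally show ?case
    unfolding Suc.hyps(2)[symmetric] by (simp add: t_fact_def)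
qed

text \<open>
  By induction each summand, as a function of the letter \<open>y\<close>, is a polynomial divided by
  \<open>\<Prod>(y - u)\<close>. At \<open>y = w \<in> Z\<close> the summand with first letter \<open>y\<close> and the one with first letter \<open>w\<close> have
  opposite residues, because exchanging \<open>y\<close> and \<open>w\<close> exchanges them; so the common numerator
  vanishes there and the division is exact.
\<close>

lemma hl_sum_insert_poly:
  assumes "finite Z" "\<And>l. l \<in> set lam \<Longrightarrow> l < D"
  shows "\<exists>p. degree p \<le> D \<and> (\<forall>y. y \<notin> Z \<longrightarrow> hl_sum t \<alpha> lam (insert y Z) (\<lambda>u. u) = poly p y)"
  using assms
proof (induction lam arbitrary: Z)
  case Nil
  show ?case by (intro exI[of _ 1]) auto
next
  case (Cons l ls)
  have "\<exists>p. degree p \<le> D \<and> (\<forall>y. y \<notin> Z - {z} \<longrightarrow>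
      hl_sum t \<alpha> ls (insert y (Z - {z})) (\<lambda>u. u) = poly p y)" for z
    by (rule Cons.IH) (use Cons.prems in auto)
  then obtain q where q: "\<And>z. degree (q z) \<le> D"
    "\<And>z y. y \<notin> Z - {z} \<Longrightarrow> hl_sum t \<alpha> ls (insert y (Z - {z})) (\<lambda>u. u) = poly (q z) y"
    by metis
  define g where "g = (\<lambda>z::complex. z ^ l * (1 - \<alpha> * z))"
  define c where "c = (\<lambda>z. \<Prod>u\<in>Z - {z}. (z - t * u) / (z - u))"
  \<comment> \<open>Numerators over \<open>\<Prod>(y - u)\<close>: first letter \<open>y\<close> in \<open>P1\<close>, first letter \<open>z \<in> Z\<close> in \<open>P2 z\<close>; the sign in \<open>P\<close> comes
    from \<open>z - y = -(y - z)\<close>.\<close>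
  define P1 where "P1 = [:0, 1:] ^ l * [:1, -\<alpha>:] * (\<Prod>u\<in>Z. [:-(t * u), 1:]) * [:hl_sum t \<alpha> ls Z (\<lambda>u. u):]"
  define P2 where "P2 = (\<lambda>z. smult (g z * c z) ([:z, -t:] * q z * (\<Prod>u\<in>Z - {z}. [:-u, 1:])))"
  define P where "P = P1 - (\<Sum>z\<in>Z. P2 z)"
  have pP1: "poly P1 y = g y * (\<Prod>u\<in>Z. y - t * u) * hl_sum t \<alpha> ls Z (\<lambda>u. u)" for y
    unfolding P1_def poly_mult poly_power poly_prod g_def by simp
  have pP2: "poly (P2 z) y = g z * c z * ((z - t * y) * poly (q z) y * (\<Prod>u\<in>Z - {z}. y - u))" for y z
    unfolding P2_def poly_smult poly_mult poly_prod by (simp add: mult.commute)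
  have main: "hl_sum t \<alpha> (l # ls) (insert y Z) (\<lambda>u. u) * (\<Prod>u\<in>Z. y - u) = poly P y"
    if y: "y \<notin> Z" for y
  proof -
    have nz: "(\<Prod>u\<in>Z. y - u) \<noteq> 0" using y Cons.prems by auto
    have t1: "(\<Prod>b\<in>Z. (y - t * b) / (y - b)) * (\<Prod>u\<in>Z. y - u) = (\<Prod>u\<in>Z. y - t * u)"
      using nz by (simp add: prod_dividef)
    have t2: "(\<Prod>b\<in>insert y Z - {z}. (z - t * b) / (z - b)) *
        hl_sum t \<alpha> ls (insert y Z - {z}) (\<lambda>u. u) * (\<Prod>u\<in>Z. y - u) =
        - (c z * ((z - t * y) * poly (q z) y * (\<Prod>u\<in>Z - {z}. y - u)))" if z: "z \<in> Z" for z
    proof -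
      have i: "insert y Z - {z} = insert y (Z - {z})" using y z by auto
      have "(\<Prod>b\<in>insert y (Z - {z}). (z - t * b) / (z - b)) = (z - t * y) / (z - y) * c z"
        using y Cons.prems by (simp add: c_def)
      moreover have "(\<Prod>u\<in>Z. y - u) = (y - z) * (\<Prod>u\<in>Z - {z}. y - u)"
        using z Cons.prems by (simp add: prod.remove)
      moreover have "z - y \<noteq> 0" using y z by auto
      moreover have "A / (z - y) * c z * R * ((y - z) * B) = - (c z * (A * R * B))" for A B R
      proof -
        have "A / (z - y) * (y - z) = - A"
          using \<open>z - y \<noteq> 0\<close> by (simp add: divide_simps) (simp add: algebra_simps)
        then have "(A / (z - y) * (y - z)) * (c z * R * B) = - A * (c z * R * B)" by simp
        then show ?thesis by (simp add: mult_ac)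
      qed
      ultimately show ?thesis unfolding i using q(2)[of y z] y by simp
    qed
    have "hl_sum t \<alpha> (l # ls) (insert y Z) (\<lambda>u. u) * (\<Prod>u\<in>Z. y - u) =
       g y * ((\<Prod>b\<in>Z. (y - t * b) / (y - b)) * (\<Prod>u\<in>Z. y - u)) * hl_sum t \<alpha> ls Z (\<lambda>u. u) +
       (\<Sum>z\<in>Z. g z * ((\<Prod>b\<in>insert y Z - {z}. (z - t * b) / (z - b)) *
        hl_sum t \<alpha> ls (insert y Z - {z}) (\<lambda>u. u) * (\<Prod>u\<in>Z. y - u)))"
      using y Cons.prems by (simp add: g_def sum_distrib_left sum_distrib_right algebra_simps)
    also have "\<dots> = poly P y"
      unfolding t1 P_def poly_diff poly_sum pP1 pP2
      using t2 by (simp add: sum_negf[symmetric] mult.assoc)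
    finally show ?thesis .
  qed
  have "poly P w = 0" if w: "w \<in> Z" for w
  proof -
    have "poly (P2 z) w = 0" if "z \<in> Z" "z \<noteq> w" for z
      using w that Cons.prems by (auto simp: pP2)
    then have "(\<Sum>z\<in>Z. poly (P2 z) w) = poly (P2 w) w"
      using w Cons.prems sum.remove[of Z w "\<lambda>z. poly (P2 z) w"] by (simp add: sum.neutral)
    moreover have "poly (q w) w = hl_sum t \<alpha> ls Z (\<lambda>u. u)"
      using q(2)[of w w] w by (simp add: insert_absorb)
    moreover have "c w * (\<Prod>u\<in>Z - {w}. w - u) = (\<Prod>u\<in>Z - {w}. w - t * u)"
      using Cons.prems by (simp add: c_def prod_dividef)
    moreover have "(\<Prod>u\<in>Z. w - t * u) = (w - t * w) * (\<Prod>u\<in>Z - {w}. w - t * u)"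
      using w Cons.prems by (simp add: prod.remove)
    ultimately show ?thesis
      by (simp add: P_def poly_sum pP1 pP2[of w w])
  qed
  then obtain p where p: "P = (\<Prod>u\<in>Z. [:-u, 1:]) * p"
    using prod_linear_factors_dvd[of Z P] Cons.prems by (auto elim: dvdE)
  have "degree P \<le> card Z + D"
    unfolding P_def
  proof (intro degree_diff_le degree_sum_le)
    have "degree P1 \<le> degree ([:0, 1:] ^ l * [:1, -\<alpha>:] * (\<Prod>u\<in>Z. [:-(t * u), 1:]))"
      unfolding P1_def by (rule order_trans[OF degree_mult_le]) simp
    also have "\<dots> \<le> degree ([:0, 1:] ^ l * [:1, -\<alpha>:]) + card Z"
      by (rule order_trans[OF degree_mult_le]) (simp add: degree_prod_eq_sum_degree)
    also have "\<dots> \<le> (l + 1) + card Z"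
      by (intro add_mono order_trans[OF degree_mult_le]) (simp_all add: degree_power_eq)
    finally show "degree P1 \<le> card Z + D" using Cons.prems(2)[of l] by simp
  next
    fix z assume z: "z \<in> Z"
    have "degree (P2 z) \<le> degree ([:z, -t:] * q z * (\<Prod>u\<in>Z - {z}. [:-u, 1:]))"
      unfolding P2_def by (rule degree_smult_le)
    also have "\<dots> \<le> (1 + D) + card (Z - {z})"
      by (intro order_trans[OF degree_mult_le] add_mono) (use q(1)[of z] in \<open>simp_all add: degree_prod_eq_sum_degree\<close>)
    also have "\<dots> = card Z + D" using z Cons.prems card_Suc_Diff1[of Z z] by simp
    finally show "degree (P2 z) \<le> card Z + D" .
  qed (use Cons.prems in auto)
  then have "degree p \<le> D"
    by (cases "p = 0") (use Cons.prems(1) in \<open>auto simp: p degree_mult_eq degree_prod_eq_sum_degree\<close>)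
  moreover have "hl_sum t \<alpha> (l # ls) (insert y Z) (\<lambda>u. u) = poly p y" if y: "y \<notin> Z" for y
  proof -
    have "(\<Prod>u\<in>Z. y - u) \<noteq> 0" using y Cons.prems by auto
    moreover have "poly P y = (\<Prod>u\<in>Z. y - u) * poly p y" by (simp add: p poly_prod)
    ultimately show ?thesis using main[OF y] by simp
  qed
  ultimately show ?case by blast
qed

section \<open>Polynomiality in all letters\<close>

text \<open>
  Polynomial functions of the coordinates in \<open>J\<close>. Boundedness on bounded sets, measurability and continuity
  follow by rule induction.
\<close>

inductive polyf :: "'i set \<Rightarrow> (('i \<Rightarrow> complex) \<Rightarrow> complex) \<Rightarrow> bool" for J where
  const: "polyf J (\<lambda>z. c)"
| coord: "i \<in> J \<Longrightarrow> polyf J (\<lambda>z. z i)"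
| add: "polyf J f \<Longrightarrow> polyf J g \<Longrightarrow> polyf J (\<lambda>z. f z + g z)"
| mult: "polyf J f \<Longrightarrow> polyf J g \<Longrightarrow> polyf J (\<lambda>z. f z * g z)"

lemma polyf_sum: "(\<And>a. a \<in> A \<Longrightarrow> polyf J (f a)) \<Longrightarrow> polyf J (\<lambda>z. \<Sum>a\<in>A. f a z)"
  by (induction A rule: infinite_finite_induct) (auto intro: polyf.intros)

lemma polyf_prod: "(\<And>a. a \<in> A \<Longrightarrow> polyf J (f a)) \<Longrightarrow> polyf J (\<lambda>z. \<Prod>a\<in>A. f a z)"
  by (induction A rule: infinite_finite_induct) (auto intro: polyf.intros)

lemma polyf_mono: "polyf J f \<Longrightarrow> J \<subseteq> J' \<Longrightarrow> polyf J' f"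
  by (induction rule: polyf.induct) (auto intro: polyf.intros)

lemma polyf_cong: "polyf J f \<Longrightarrow> (\<And>i. i \<in> J \<Longrightarrow> z i = z' i) \<Longrightarrow> f z = f z'"
  by (induction rule: polyf.induct) auto

lemma polyf_measurable:
  "polyf J f \<Longrightarrow> (\<And>i. i \<in> J \<Longrightarrow> (\<lambda>x. \<zeta> x i) \<in> borel_measurable M) \<Longrightarrow>
    (\<lambda>x. f (\<zeta> x)) \<in> borel_measurable M"
  by (induction rule: polyf.induct) auto

lemma polyf_tendsto:
  "polyf J f \<Longrightarrow> (\<And>i. i \<in> J \<Longrightarrow> ((\<lambda>x. \<zeta> x i) \<longlongrightarrow> z i) F) \<Longrightarrow> ((\<lambda>x. f (\<zeta> x)) \<longlongrightarrow> f z) F"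
  by (induction rule: polyf.induct) (auto intro!: tendsto_intros)

lemma polyf_bounded:
  "polyf J f \<Longrightarrow> \<exists>C. \<forall>z. (\<forall>i\<in>J. cmod (z i) \<le> B) \<longrightarrow> cmod (f z) \<le> C"
proof (induction rule: polyf.induct)
  case (add f g)
  then obtain C C' where "\<forall>z. (\<forall>i\<in>J. cmod (z i) \<le> B) \<longrightarrow> cmod (f z) \<le> C"
    "\<forall>z. (\<forall>i\<in>J. cmod (z i) \<le> B) \<longrightarrow> cmod (g z) \<le> C'" by blast
  then have "\<forall>z. (\<forall>i\<in>J. cmod (z i) \<le> B) \<longrightarrow> cmod (f z + g z) \<le> C + C'"
    by (meson norm_triangle_mono)
  then show ?case by blast
next
  case (mult f g)
  then obtain C C' where "\<forall>z. (\<forall>i\<in>J. cmod (z i) \<le> B) \<longrightarrow> cmod (f z) \<le> C"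
    "\<forall>z. (\<forall>i\<in>J. cmod (z i) \<le> B) \<longrightarrow> cmod (g z) \<le> C'" by blast
  then have "\<forall>z. (\<forall>i\<in>J. cmod (z i) \<le> B) \<longrightarrow> cmod (f z * g z) \<le> C * C'"
    by (simp add: norm_mult mult_mono' order_trans[OF norm_ge_zero])
  then show ?case by blast
qed auto

text \<open>
  The letters in \<open>J - J1\<close> are frozen at distinct values of modulus greater than \<open>B\<close>. To release a further
  letter \<open>a\<close>, the sum, a polynomial in \<open>z a\<close>, is interpolated between finitely many frozen values
  of \<open>a\<close>. Interpolation nodes outside the disc of radius \<open>B\<close> never meet a released letter, so
  the sum at the nodes is given by its rational expression.
\<close>

lemma hl_sum_polyf_partial:
  assumes "finite J1" "finite J" "J1 \<subseteq> J" "inj_on c (J - J1)" "\<And>a. a \<in> J - J1 \<Longrightarrow> B < cmod (c a)"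
  shows "\<exists>Q. polyf J1 Q \<and> (\<forall>z. inj_on z J1 \<and> (\<forall>a\<in>J1. cmod (z a) \<le> B) \<and> (\<forall>a\<in>J - J1. z a = c a) \<longrightarrow>
     hl_sum t \<alpha> lam J z = Q z)"
  using assms
proof (induction J1 arbitrary: c rule: finite_induct)
  case empty
  show ?case
    by (intro exI[of _ "\<lambda>z. hl_sum t \<alpha> lam J c"]) (auto intro!: polyf.const hl_sum_cong)
next
  case (insert a J1)
  obtain D where D: "\<And>l. l \<in> set lam \<Longrightarrow> l < D"
    using finite_nat_set_iff_bounded[of "set lam"] by auto
  let ?c = "c ` (J - insert a J1)"
  obtain A where A: "finite A" "card A = Suc D" "A \<subseteq> {w. B < cmod w} - ?c"
  proof -
    have "inj (\<lambda>n. of_real (\<bar>B\<bar> + 1 + real n) :: complex)" by (auto intro!: injI)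
    then have "infinite (range (\<lambda>n. of_real (\<bar>B\<bar> + 1 + real n) :: complex))"
      by (rule range_inj_infinite)
    moreover have "range (\<lambda>n. of_real (\<bar>B\<bar> + 1 + real n) :: complex) \<subseteq> {w. B < cmod w}"
      by (auto simp del: of_real_add)
    ultimately have "infinite {w::complex. B < cmod w}" using finite_subset by blast
    then have "infinite ({w. B < cmod w} - ?c)" using insert.prems by (intro Diff_infinite_finite) auto
    then show thesis using that infinite_arbitrarily_large by blast
  qed
  have "\<exists>Q. polyf J1 Q \<and> (\<forall>z. inj_on z J1 \<and> (\<forall>a\<in>J1. cmod (z a) \<le> B) \<and>
      (\<forall>b\<in>J - J1. z b = (c(a := n)) b) \<longrightarrow> hl_sum t \<alpha> lam J z = Q z)" if n: "n \<in> A" for n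
  proof (rule insert.IH)
    have J: "J - J1 = insert a (J - insert a J1)" using insert by auto
    have "inj_on (c(a := n)) (J - insert a J1)"
      using insert.prems(3) by (auto simp: inj_on_def)
    then show "inj_on (c(a := n)) (J - J1)"
      unfolding J using A(3) n by (auto simp: inj_on_insert)
    show "B < cmod ((c(a := n)) b)" if "b \<in> J - J1" for b
      using that A(3) n insert.prems(4)[of b] unfolding J by auto
  qed (use insert.prems in auto)
  then obtain Q where Q: "\<And>n. n \<in> A \<Longrightarrow> polyf J1 (Q n)"
    "\<And>n z. n \<in> A \<Longrightarrow> inj_on z J1 \<Longrightarrow> (\<And>a. a \<in> J1 \<Longrightarrow> cmod (z a) \<le> B) \<Longrightarrow>
      (\<And>b. b \<in> J - J1 \<Longrightarrow> z b = (c(a := n)) b) \<Longrightarrow> hl_sum t \<alpha> lam J z = Q n z"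
    by metis
  define Q' where "Q' = (\<lambda>z. \<Sum>n\<in>A. Q n z * (\<Prod>m\<in>A - {n}. (z a + - m) * (1 / (n - m))))"
  have "polyf (insert a J1) Q'"
    unfolding Q'_def
    by (intro polyf_sum polyf.mult polyf_prod polyf.add polyf.const polyf.coord)
       (auto intro: polyf_mono[OF Q(1)])
  moreover have "hl_sum t \<alpha> lam J z = Q' z"
    if z: "inj_on z (insert a J1)" "\<forall>b\<in>insert a J1. cmod (z b) \<le> B" "\<forall>b\<in>J - insert a J1. z b = c b" for z
  proof -
    let ?Z = "z ` (J - {a})"
    have J: "J = insert a J1 \<union> (J - insert a J1)" using insert.prems by auto
    have "inj_on z (J - insert a J1)"
      using inj_on_cong[of "J - insert a J1" z c, THEN iffD2] insert.prems(3) z(3) by (simp add: inj_on_def)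
    moreover have "z b \<noteq> z b'" if "b \<in> insert a J1" "b' \<in> J - insert a J1" for b b'
      using z(2,3) insert.prems(4)[of b'] that by force
    ultimately have inj: "inj_on z J"
      using z(1) by (subst J, subst inj_on_Un) blast
    obtain p where p: "degree p \<le> D"
      "\<And>y. y \<notin> ?Z \<Longrightarrow> hl_sum t \<alpha> lam (insert y ?Z) (\<lambda>u. u) = poly p y"
      using hl_sum_insert_poly[of ?Z lam D t \<alpha>] D insert.prems by auto
    have za: "hl_sum t \<alpha> lam J (z(a := y)) = poly p y" if y: "y \<notin> ?Z" for y
    proof -
      have im: "(z(a := y)) ` J = insert y ?Z"
        using insert.prems(2) by auto
      have "inj_on (z(a := y)) J"
        using inj y by (auto simp: inj_on_def)
      from hl_sum_image[OF this] show ?thesis using p(2)[OF y] unfolding im by simp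
    qed
    have "z a \<notin> ?Z" using inj insert.prems(2) by (auto dest: inj_onD)
    from za[OF this] have "hl_sum t \<alpha> lam J z = poly p (z a)" by simp
    also have "\<dots> = (\<Sum>n\<in>A. poly p n * (\<Prod>m\<in>A - {n}. (z a - m) / (n - m)))"
      by (rule lagrange_interpolation) (use A p in auto)
    also have "\<dots> = Q' z"
      unfolding Q'_def
    proof (intro sum.cong refl arg_cong2[where f = "(*)"])
      fix n assume n: "n \<in> A"
      have "n \<notin> ?Z"
      proof
        assume "n \<in> ?Z"
        then obtain b where b: "b \<in> J" "b \<noteq> a" "n = z b" by auto
        show False
        proof (cases "b \<in> J1")
          case True then show False using z(2) b A(3) n by force
        next
          case False then show False using z(3) b A(3) n by auto
        qed
      qed
      from za[OF this] have "poly p n = hl_sum t \<alpha> lam J (z(a := n))" by simp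
      also have "\<dots> = Q n (z(a := n))"
      proof (rule Q(2)[OF n])
        show "inj_on (z(a := n)) J1" using z(1) insert.hyps by (auto simp: inj_on_def)
      qed (use z insert.hyps in auto)
      also have "\<dots> = Q n z"
        by (rule polyf_cong[OF Q(1)[OF n]]) (use insert.hyps in auto)
      finally show "poly p n = Q n z" .
    qed simp
    finally show ?thesis .
  qed
  ultimately show ?case by blast
qed

lemma hl_sum_polyf:
  assumes "finite J"
  shows "\<exists>Q. polyf J Q \<and> (\<forall>z. inj_on z J \<and> (\<forall>a\<in>J. cmod (z a) \<le> B) \<longrightarrow> hl_sum t \<alpha> lam J z = Q z)"
  using hl_sum_polyf_partial[of J J undefined B t \<alpha> lam] assms by auto

lemma hl_sum_measurable:
  "(\<And>a. a \<in> J \<Longrightarrow> (\<lambda>x. z x a) \<in> borel_measurable M) \<Longrightarrow>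
    (\<lambda>x. hl_sum t \<alpha> lam J (z x)) \<in> borel_measurable M"
proof (induction lam arbitrary: J)
  case (Cons l ls)
  have [measurable]: "(\<lambda>x. hl_sum t \<alpha> ls (J - {a}) (z x)) \<in> borel_measurable M" for a
    by (rule Cons.IH) (use Cons.prems in auto)
  show ?case
    unfolding hl_sum.simps
    by (intro borel_measurable_sum borel_measurable_times borel_measurable_prod
        borel_measurable_divide borel_measurable_diff borel_measurable_power borel_measurable_const Cons.prems)
       auto
qed simp

section \<open>The Hall--Littlewood polynomial as a sum over orderings\<close>

lemma hl_sum_permutations_of_set:
  assumes "finite J" "card J = length lam"
  shows "hl_sum t \<alpha> lam J z = (\<Sum>xs\<in>permutations_of_set J.
     (\<Prod>i<length lam. z (xs ! i) ^ (lam ! i) * (1 - \<alpha> * z (xs ! i))) *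
     (\<Prod>(i, j)\<in>{(i, j). i < j \<and> j < length lam}. (z (xs ! i) - t * z (xs ! j)) / (z (xs ! i) - z (xs ! j))))"
  using assms
proof (induction lam arbitrary: J)
  case Nil
  then show ?case by simp
next
  case (Cons l ls)
  let ?n = "length ls"
  define G where "G = (\<lambda>lam xs. (\<Prod>i<length lam. z (xs ! i) ^ (lam ! i) * (1 - \<alpha> * z (xs ! i))) *
     (\<Prod>(i, j)\<in>{(i, j). i < j \<and> j < length lam}. (z (xs ! i) - t * z (xs ! j)) / (z (xs ! i) - z (xs ! j))))"
  have G: "G (l # ls) (a # ys) = z a ^ l * (1 - \<alpha> * z a) *
      (\<Prod>b\<in>J - {a}. (z a - t * z b) / (z a - z b)) * G ls ys"
    if a: "a \<in> J" and ys: "ys \<in> permutations_of_set (J - {a})" for a ys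
  proof -
    have ly: "length ys = ?n" "distinct ys" "set ys = J - {a}"
      using ys Cons.prems a by (auto simp: length_finite_permutations_of_set permutations_of_set_def distinct_card[symmetric])
    have eq: "{(i, j). i < j \<and> j < Suc ?n} = (\<lambda>j. (0, Suc j)) ` {..<?n} \<union>
        (\<lambda>(i, j). (Suc i, Suc j)) ` {(i, j). i < j \<and> j < ?n}"
    proof -
      have "x \<in> (\<lambda>j. (0, Suc j)) ` {..<?n} \<union> (\<lambda>(i, j). (Suc i, Suc j)) ` {(i, j). i < j \<and> j < ?n}"
        if "x \<in> {(i, j). i < j \<and> j < Suc ?n}" for x
      proof -
        obtain i j where x: "x = (i, Suc j)" "i < Suc j" "j < ?n"
          using \<open>x \<in> _\<close> by (cases x, cases "snd x") auto
        then show ?thesis by (cases i) (auto simp: image_iff)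
      qed
      then show ?thesis by auto
    qed
    have fin: "finite {(i, j). i < j \<and> j < ?n}"
      by (rule finite_subset[of _ "{..<?n} \<times> {..<?n}"]) auto
    have "(\<Prod>(i, j)\<in>{(i, j). i < j \<and> j < Suc ?n}.
        (z ((a # ys) ! i) - t * z ((a # ys) ! j)) / (z ((a # ys) ! i) - z ((a # ys) ! j))) =
       (\<Prod>j<?n. (z a - t * z (ys ! j)) / (z a - z (ys ! j))) *
       (\<Prod>(i, j)\<in>{(i, j). i < j \<and> j < ?n}. (z (ys ! i) - t * z (ys ! j)) / (z (ys ! i) - z (ys ! j)))"
      unfolding eq using fin
      by (subst prod.union_disjoint) (auto simp: prod.reindex inj_on_def split_def)
    moreover have "(\<Prod>j<?n. (z a - t * z (ys ! j)) / (z a - z (ys ! j))) =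
        (\<Prod>b\<in>J - {a}. (z a - t * z b) / (z a - z b))"
      using bij_betw_nth[OF ly(2), of "{..<?n}" "J - {a}"] ly
      by (intro prod.reindex_bij_betw[of "\<lambda>j. ys ! j"]) auto
    ultimately show ?thesis
      unfolding G_def by (simp add: prod.lessThan_Suc_shift mult_ac del: prod.lessThan_Suc)
  qed
  have "J \<noteq> {}" using Cons.prems by auto
  then have "(\<Sum>xs\<in>permutations_of_set J. G (l # ls) xs) =
      (\<Sum>a\<in>J. \<Sum>xs\<in>(#) a ` permutations_of_set (J - {a}). G (l # ls) xs)"
    by (subst permutations_of_set_nonempty) (use Cons.prems in \<open>auto intro!: sum.UNION_disjoint\<close>)
  also have "\<dots> = (\<Sum>a\<in>J. \<Sum>ys\<in>permutations_of_set (J - {a}). G (l # ls) (a # ys))"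
    by (simp add: sum.reindex)
  also have "\<dots> = (\<Sum>a\<in>J. z a ^ l * (1 - \<alpha> * z a) *
      (\<Prod>b\<in>J - {a}. (z a - t * z b) / (z a - z b)) * (\<Sum>ys\<in>permutations_of_set (J - {a}). G ls ys))"
    by (simp add: G sum_distrib_left)
  also have "\<dots> = hl_sum t \<alpha> (l # ls) J z"
    using Cons.prems by (simp add: Cons.IH G_def)
  finally show ?case by (simp only: G_def)
qed

lemma bij_betw_permutes_permutations_of_set:
  "bij_betw (\<lambda>w. map w [0..<n]) {w. w permutes {..<n}} (permutations_of_set {..<n})"
proof -
  let ?f = "\<lambda>w. map w [0..<n]"
  have inj: "inj_on ?f {w. w permutes {..<n}}"
  proof (rule inj_onI)
    fix w w' assume w: "w \<in> {w. w permutes {..<n}}" "w' \<in> {w. w permutes {..<n}}" "?f w = ?f w'"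
    then have "w i = w' i" if "i < n" for i using that by auto
    moreover have "w i = w' i" if "\<not> i < n" for i
      using w that by (simp add: permutes_not_in)
    ultimately show "w = w'" by blast
  qed
  moreover have "?f ` {w. w permutes {..<n}} \<subseteq> permutations_of_set {..<n}"
    by (auto simp: permutations_of_set_def distinct_map atLeast0LessThan permutes_image permutes_inj_on)
  then have "?f ` {w. w permutes {..<n}} = permutations_of_set {..<n}"
    by (rule card_subset_eq[rotated]) (simp_all add: card_image[OF inj] card_permutations[of "{..<n}" n])
  ultimately show ?thesis by (auto simp: bij_betw_def)
qed

text \<open>
  The symmetric product of the factors \<open>1 - \<alpha>z\<^sub>i\<close> is moved into the symmetrisation.
\<close>

lemma hl_expr_times_prod:
  "hl_expr lam t z * (\<Prod>i<length lam. 1 - \<alpha> * z i) =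
    hl_sum t \<alpha> lam {..<length lam} z / v_part lam t"
proof -
  let ?N = "length lam"
  have "hl_sum t \<alpha> lam {..<?N} z = (\<Sum>w | w permutes {..<?N}.
     (\<Prod>i<?N. z (w i) ^ (lam ! i) * (1 - \<alpha> * z (w i))) *
     (\<Prod>(i, j)\<in>{(i, j). i < j \<and> j < ?N}. (z (w i) - t * z (w j)) / (z (w i) - z (w j))))"
    by (subst hl_sum_permutations_of_set, simp, simp,
        subst sum.reindex_bij_betw[OF bij_betw_permutes_permutations_of_set[of ?N], symmetric])
       (auto intro!: sum.cong arg_cong2[where f = "(*)"] prod.cong)
  also have "\<dots> = (\<Sum>w | w permutes {..<?N}. ((\<Prod>i<?N. z (w i) ^ (lam ! i)) *
     (\<Prod>(i, j)\<in>{(i, j). i < j \<and> j < ?N}. (z (w i) - t * z (w j)) / (z (w i) - z (w j)))) *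
     (\<Prod>i<?N. 1 - \<alpha> * z i))"
  proof (intro sum.cong refl)
    fix w assume "w \<in> {w. w permutes {..<?N}}"
    then have "(\<Prod>i<?N. 1 - \<alpha> * z (w i)) = (\<Prod>i<?N. 1 - \<alpha> * z i)"
      using prod.permute[of w "{..<?N}" "\<lambda>i. 1 - \<alpha> * z i"] by (simp add: o_def)
    then show "(\<Prod>i<?N. z (w i) ^ (lam ! i) * (1 - \<alpha> * z (w i))) *
     (\<Prod>(i, j)\<in>{(i, j). i < j \<and> j < ?N}. (z (w i) - t * z (w j)) / (z (w i) - z (w j))) =
     ((\<Prod>i<?N. z (w i) ^ (lam ! i)) *
     (\<Prod>(i, j)\<in>{(i, j). i < j \<and> j < ?N}. (z (w i) - t * z (w j)) / (z (w i) - z (w j)))) *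
     (\<Prod>i<?N. 1 - \<alpha> * z i)"
      by (simp add: prod.distrib)
  qed
  finally show ?thesis
    unfolding hl_expr_def by (simp add: sum_distrib_right)
qed

text \<open>
  Every point is a limit of points with distinct coordinates: shift the \<open>i\<close>-th coordinate by \<open>c (i + 1)\<close> and
  let \<open>c\<close> tend to \<open>0\<close>.
\<close>

lemma at_within_inj_on_nontrivial:
  fixes z :: "nat \<Rightarrow> complex"
  shows "at z within {y. inj_on y {..<N}} \<noteq> bot"
proof -
  let ?g = "\<lambda>c::complex. \<lambda>i::nat. z i + c * of_nat (i + 1)"
  define S where "S = (\<lambda>(i, j). (z j - z i) / (of_nat i - of_nat j)) ` ({..<N} \<times> {..<N}) - {0}"
  have "continuous_on UNIV ?g"
    by (rule continuous_on_coordinatewise_then_product) (intro continuous_intros)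
  then have "(?g \<longlongrightarrow> ?g 0) (at 0)"
    unfolding continuous_on_def by blast
  moreover have "eventually (\<lambda>c. ?g c \<noteq> z \<and> ?g c \<in> {y. inj_on y {..<N}}) (at 0)"
  proof -
    have "eventually (\<lambda>c. c \<notin> S) (at 0)"
    proof -
      have "finite S" by (auto simp: S_def)
      then have "open (- S)" by (intro open_Compl finite_imp_closed)
      moreover have "0 \<in> - S" by (auto simp: S_def)
      ultimately show ?thesis by (auto simp: eventually_at_topological)
    qed
    moreover have "eventually (\<lambda>c::complex. c \<noteq> 0) (at 0)"
      by (simp add: eventually_at_filter)
    ultimately show ?thesis
    proof eventually_elim
      case c: (elim c)
      have "?g c \<noteq> z"
      proof
        assume "?g c = z"
        then have "?g c 0 = z 0" by (rule fun_cong)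
        then show False using c by simp
      qed
      moreover have "inj_on (?g c) {..<N}"
      proof (rule inj_onI, rule ccontr)
        fix i j assume ij: "i \<in> {..<N}" "j \<in> {..<N}" "?g c i = ?g c j" "i \<noteq> j"
        then have "z i + c * of_nat (i + 1) = z j + c * of_nat (j + 1)" by blast
        then have "c * (of_nat i - of_nat j) = z j - z i" by (simp add: algebra_simps)
        moreover have "(of_nat i - of_nat j :: complex) \<noteq> 0" using ij by simp
        ultimately have "c = (z j - z i) / (of_nat i - of_nat j)" by (simp add: eq_divide_eq)
        moreover have "(i, j) \<in> {..<N} \<times> {..<N}" using ij by blast
        ultimately have "c \<in> S" using c unfolding S_def
          by (intro DiffI image_eqI[of _ _ "(i, j)"]) simp_all
        then show False using c by blast
      qed
      ultimately show ?case by simp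
    qed
  qed
  ultimately have "filterlim ?g (at z within {y. inj_on y {..<N}}) (at 0)"
    by (auto simp: filterlim_at elim: eventually_mono)
  then show ?thesis
    by (metis filterlim_def filtermap_bot_iff bot.extremum_uniqueI at_neq_bot)
qed

lemma hall_littlewood_polyf:
  assumes Q: "polyf {..<length lam} Q"
    "\<And>z. inj_on z {..<length lam} \<Longrightarrow> (\<And>a. a < length lam \<Longrightarrow> cmod (z a) \<le> B) \<Longrightarrow>
       hl_sum t 0 lam {..<length lam} z = Q z"
    and z: "\<And>a. a < length lam \<Longrightarrow> cmod (z a) < B"
  shows "hall_littlewood lam t z = Q z / v_part lam t"
proof -
  let ?D = "{y::nat \<Rightarrow> complex. inj_on y {..<length lam}}"
  have co: "((\<lambda>y::nat \<Rightarrow> complex. y i) \<longlongrightarrow> z i) (at z within ?D)" for i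
  proof -
    have "continuous_on UNIV (\<lambda>y::nat \<Rightarrow> complex. y i)"
      by (rule continuous_on_product_coordinates)
    then show ?thesis
      by (auto simp: continuous_on_def intro: tendsto_within_subset)
  qed
  have "eventually (\<lambda>y. \<forall>a\<in>{..<length lam}. cmod (y a) < B) (at z within ?D)"
    by (intro eventually_ball_finite ballI order_tendstoD(2)[OF tendsto_norm[OF co]]) (use z in auto)
  moreover have "eventually (\<lambda>y. y \<in> ?D) (at z within ?D)"
    by (auto simp: eventually_at_filter)
  ultimately have ev: "eventually (\<lambda>y. hl_expr lam t y = Q y / v_part lam t) (at z within ?D)"
  proof eventually_elim
    case (elim y)
    then have "hl_sum t 0 lam {..<length lam} y = Q y" by (intro Q(2)) (auto intro: less_imp_le)
    then show ?case using hl_expr_times_prod[of lam t y 0] by simp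
  qed
  have "((\<lambda>y. Q y / v_part lam t) \<longlongrightarrow> Q z / v_part lam t) (at z within ?D)"
    unfolding divide_inverse by (intro tendsto_mult tendsto_const polyf_tendsto[OF Q(1)] co)
  then have "(hl_expr lam t \<longlongrightarrow> Q z / v_part lam t) (at z within ?D)"
    using tendsto_cong[OF ev] by blast
  then show ?thesis
    unfolding hall_littlewood_def by (intro tendsto_Lim at_within_inj_on_nontrivial)
qed

text \<open>
  The limit agrees with a polynomial on every ball, hence it is the pointwise limit of these polynomials as
  the radius grows. This covers the points with coinciding coordinates, where being
  negligible would not be enough for Borel measurability.
\<close>

lemma hall_littlewood_measurable:
  assumes \<zeta>: "\<And>i. i < length lam \<Longrightarrow> (\<lambda>x. \<zeta> x i) \<in> borel_measurable M"
  shows "(\<lambda>x. hall_littlewood lam t (\<zeta> x)) \<in> borel_measurable M"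
proof -
  let ?N = "length lam"
  have "\<exists>Q. polyf {..<?N} Q \<and> (\<forall>z. inj_on z {..<?N} \<and> (\<forall>a\<in>{..<?N}. cmod (z a) \<le> real m) \<longrightarrow>
      hl_sum t 0 lam {..<?N} z = Q z)" for m
    by (rule hl_sum_polyf) simp
  then obtain Q where Q: "\<And>m. polyf {..<?N} (Q m)"
    "\<And>m z. inj_on z {..<?N} \<Longrightarrow> (\<And>a. a < ?N \<Longrightarrow> cmod (z a) \<le> real m) \<Longrightarrow>
      hl_sum t 0 lam {..<?N} z = Q m z"
    by (metis lessThan_iff)
  show ?thesis
  proof (rule borel_measurable_LIMSEQ_metric)
    show "(\<lambda>x. Q m (\<zeta> x) / v_part lam t) \<in> borel_measurable M" for m
      by (intro borel_measurable_divide borel_measurable_const polyf_measurable[OF Q(1)]) (use \<zeta> in auto)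
    show "(\<lambda>m. Q m (\<zeta> x) / v_part lam t) \<longlonglongrightarrow> hall_littlewood lam t (\<zeta> x)" for x
    proof -
      obtain m0 where m0: "\<And>a. a < ?N \<Longrightarrow> cmod (\<zeta> x a) < real m0"
      proof -
        obtain m0 where "(\<Sum>a<?N. cmod (\<zeta> x a)) < real m0" using reals_Archimedean2 by blast
        moreover have "cmod (\<zeta> x a) \<le> (\<Sum>a<?N. cmod (\<zeta> x a))" if "a < ?N" for a
          using that by (intro member_le_sum) auto
        ultimately show thesis using that by (meson le_less_trans)
      qed
      have "eventually (\<lambda>m. Q m (\<zeta> x) / v_part lam t = hall_littlewood lam t (\<zeta> x)) sequentially"
        using eventually_ge_at_top[of m0]
      proof eventually_elim
        case (elim m)
        then have "cmod (\<zeta> x a) < real m" if "a < ?N" for a using m0[OF that] by simp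
        then show ?case by (intro hall_littlewood_polyf[symmetric] Q) auto
      qed
      then show ?thesis by (rule tendsto_eventually)
    qed
  qed
qed

section \<open>Integration over the unit circle\<close>

lemma circle_param_measurable [measurable]:
  "(\<lambda>\<theta>::real. cis (2 * pi * \<theta>)) \<in> borel_measurable (restrict_space lborel {0..1})"
proof -
  have "(\<lambda>\<theta>::real. cis (2 * pi * \<theta>)) \<in> borel_measurable borel"
    by (intro borel_measurable_continuous_onI continuous_intros)
  then show ?thesis by (intro measurable_restrict_space1) simp
qed

lemma sets_circle_measure [simp, measurable_cong]: "sets circle_measure = sets borel"
  by (simp add: circle_measure_def)

lemma space_circle_measure [simp]: "space circle_measure = UNIV"
  by (simp add: circle_measure_def)

lemma prob_space_circle_measure: "prob_space circle_measure"
  unfolding circle_measure_def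
  by (intro prob_space.prob_space_distr prob_spaceI circle_param_measurable)
     (simp add: space_restrict_space emeasure_restrict_space)

lemma AE_circle_measure_norm: "AE y in circle_measure. cmod y = 1"
  unfolding circle_measure_def by (subst AE_distr_iff) auto

lemma AE_cis_neq: "AE \<theta> in lborel. cis (2 * pi * \<theta>) \<noteq> c"
proof (cases "\<exists>\<theta>0::real. cis (2 * pi * \<theta>0) = c")
  case True
  then obtain \<theta>0 where \<theta>0: "cis (2 * pi * \<theta>0) = c" by blast
  have "{\<theta>. cis (2 * pi * \<theta>) = c} \<subseteq> range (\<lambda>n::int. \<theta>0 + of_int n)"
  proof
    fix \<theta> assume "\<theta> \<in> {\<theta>. cis (2 * pi * \<theta>) = c}"
    then have "cis (2 * pi * \<theta>) / cis (2 * pi * \<theta>0) = 1" using \<theta>0 by auto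
    then have "cis (2 * pi * (\<theta> - \<theta>0)) = 1" by (simp add: cis_divide algebra_simps)
    then have "cos (2 * pi * (\<theta> - \<theta>0)) = 1" by (simp add: complex_eq_iff)
    then obtain n :: int where "2 * pi * (\<theta> - \<theta>0) = of_int n * 2 * pi"
      unfolding cos_one_2pi_int by (auto simp: mult_ac)
    then have "\<theta> = \<theta>0 + of_int n" by simp
    then show "\<theta> \<in> range (\<lambda>n::int. \<theta>0 + of_int n)" by blast
  qed
  then have "countable {\<theta>. cis (2 * pi * \<theta>) = c}" by (rule countable_subset) simp
  then have "{\<theta>. cis (2 * pi * \<theta>) = c} \<in> null_sets lborel" by (rule countable_imp_null_set_lborel)
  then show ?thesis by (rule AE_I'[of _ lborel]) auto
qed auto

lemma AE_circle_measure_neq: "AE y in circle_measure. y \<noteq> c"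
proof -
  have "AE \<theta> in restrict_space lborel {0..1}. cis (2 * pi * \<theta>) \<noteq> c"
    using AE_cis_neq[of c] by (subst AE_restrict_space_iff) auto
  then show ?thesis unfolding circle_measure_def by (subst AE_distr_iff) auto
qed

lemma mean_value_has_integral:
  assumes "H holomorphic_on ball 0 \<rho>" "1 < \<rho>"
  shows "((\<lambda>\<theta>. H (cis (2 * pi * \<theta>))) has_integral H 0) {0..1}"
proof -
  have sub: "cball 0 1 \<subseteq> ball (0::complex) \<rho>" "ball 0 1 \<subseteq> ball (0::complex) \<rho>" using assms(2) by auto
  have "((\<lambda>u. H u / (u - 0)) has_contour_integral (2 * of_real pi * \<i> * H 0)) (circlepath 0 1)"
    by (rule Cauchy_integral_circlepath)
       (use holomorphic_on_subset[OF assms(1) sub(2)]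
            holomorphic_on_imp_continuous_on[OF holomorphic_on_subset[OF assms(1) sub(1)]] in auto)
  then have "((\<lambda>x. H (circlepath 0 1 x) / circlepath 0 1 x *
      vector_derivative (circlepath 0 1) (at x within {0..1})) has_integral (2 * of_real pi * \<i> * H 0)) {0..1}"
    by (simp add: has_contour_integral_def)
  moreover have "H (circlepath 0 1 x) / circlepath 0 1 x *
      vector_derivative (circlepath 0 1) (at x within {0..1}) = (2 * of_real pi * \<i>) * H (cis (2 * pi * x))"
    if "x \<in> {0..1}" for x
  proof -
    have "exp (2 * of_real pi * \<i> * of_real x) = cis (2 * pi * x)"
      by (simp add: cis_conv_exp mult_ac)
    then show ?thesis using that
      by (simp add: vector_derivative_circlepath01) (simp add: circlepath)
  qed
  moreover define c where "c = 2 * of_real pi * \<i>"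
  ultimately have "((\<lambda>x. c * H (cis (2 * pi * x))) has_integral c * H 0) {0..1}"
    using has_integral_cong by (metis (no_types, lifting))
  from has_integral_mult_right[OF this, of "inverse c"] show ?thesis
    by (simp add: mult.assoc[symmetric] c_def[THEN arg_cong, of "\<lambda>c. c = 0"])
qed

text \<open>
  The linear function interpolating \<open>E\<close> at \<open>1\<close> and \<open>-1\<close> is subtracted; the difference is divisible by
  \<open>y\<^sup>2 - 1\<close>.
\<close>

lemma split_off_poles:
  assumes E: "E holomorphic_on ball 0 \<rho>" and \<rho>: "1 < \<rho>"
  obtains H where "H holomorphic_on ball 0 \<rho>"
    "\<And>y. y \<in> ball 0 \<rho> \<Longrightarrow> E y = (1 + y) / 2 * E 1 + (1 - y) / 2 * E (-1) + (y\<^sup>2 - 1) * H y"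
proof -
  define N where "N = (\<lambda>y. E y - (1 + y) / 2 * E 1 - (1 - y) / 2 * E (-1))"
  have N: "N holomorphic_on ball 0 \<rho>" unfolding N_def by (intro holomorphic_intros E) auto
  define H1 where "H1 = (\<lambda>y. if y = 1 then deriv N 1 else (N y - N 1) / (y - 1))"
  have H1: "H1 holomorphic_on ball 0 \<rho>" unfolding H1_def by (rule pole_lemma[OF N]) (use \<rho> in auto)
  define H where "H = (\<lambda>y. if y = -1 then deriv H1 (-1) else (H1 y - H1 (-1)) / (y - (-1)))"
  have H: "H holomorphic_on ball 0 \<rho>" unfolding H_def by (rule pole_lemma[OF H1]) (use \<rho> in auto)
  have N0: "N 1 = 0" "N (-1) = 0" by (simp_all add: N_def)
  have "H1 (-1) = 0" by (simp add: H1_def N0)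
  then have "H1 y = (y + 1) * H y" for y
    using eq_neg_iff_add_eq_0[of y 1] by (cases "y = -1") (simp_all add: H_def)
  moreover have "N y = (y - 1) * H1 y" for y by (simp add: H1_def N0)
  ultimately have "N y = (y\<^sup>2 - 1) * H y" for y by (simp add: power2_eq_square algebra_simps)
  then have "E y = (1 + y) / 2 * E 1 + (1 - y) / 2 * E (-1) + (y\<^sup>2 - 1) * H y" for y
    unfolding N_def by (simp add: algebra_simps)
  with H that show thesis by blast
qed

text \<open>
  The polar parts cancel between \<open>y\<close> and \<open>y\<^sup>-\<^sup>1\<close> up to constants, because
  \<open>1 / (y - 1) + 1 / (y\<^sup>-\<^sup>1 - 1) = -1\<close> and \<open>1 / (y + 1) + 1 / (y\<^sup>-\<^sup>1 + 1) = 1\<close>.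
\<close>

lemma symmetrized_split:
  fixes H :: "complex \<Rightarrow> complex"
  assumes E: "\<And>y. y \<in> ball 0 \<rho> \<Longrightarrow> E y = (1 + y) / 2 * E 1 + (1 - y) / 2 * E (-1) + (y\<^sup>2 - 1) * H y"
    and "1 < \<rho>" "cmod y = 1" "y\<^sup>2 \<noteq> 1"
  shows "E y / (y\<^sup>2 - 1) + E (inverse y) / ((inverse y)\<^sup>2 - 1) =
    H y + H (inverse y) - (E 1 + E (-1)) / 2"
proof -
  have y: "y \<noteq> 0" "y \<noteq> 1" "y \<noteq> -1" "inverse y \<noteq> 1" "inverse y \<noteq> -1"
    using assms(3,4) by (auto simp: inverse_eq_iff_eq[of y "-1", simplified])
  have sq: "w\<^sup>2 - 1 = (w - 1) * (w + 1)" for w :: complex by (simp add: power2_eq_square algebra_simps)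
  have *: "E w / (w\<^sup>2 - 1) = E 1 / 2 * (1 / (w - 1)) - E (-1) / 2 * (1 / (w + 1)) + H w"
    if w: "w \<in> ball 0 \<rho>" "w \<noteq> 1" "w \<noteq> -1" for w
  proof -
    have nz: "w - 1 \<noteq> 0" "w + 1 \<noteq> 0" using w by (auto simp: eq_neg_iff_add_eq_0)
    have "E 1 / 2 * (1 / (w - 1)) - E (-1) / 2 * (1 / (w + 1)) + H w =
       (((1 + w) / 2 * E 1 + (1 - w) / 2 * E (-1)) + (w\<^sup>2 - 1) * H w) / (w\<^sup>2 - 1)"
    proof -
      have "a / 2 * (1 / p) - b / 2 * (1 / q) + h = ((q / 2 * a - p / 2 * b) + p * q * h) / (p * q)"
        if "p \<noteq> 0" "q \<noteq> 0" for a b h p q :: complex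
        using that by (simp add: field_simps)
      moreover have "(w + 1) / 2 * E 1 - (w - 1) / 2 * E (-1) = (1 + w) / 2 * E 1 + (1 - w) / 2 * E (-1)"
        by (simp add: field_simps)
      ultimately show ?thesis unfolding sq using nz by metis
    qed
    then show ?thesis using E[OF w(1)] by simp
  qed
  have nz: "y - 1 \<noteq> 0" "y + 1 \<noteq> 0" "1 - y \<noteq> 0" using y by (auto simp: eq_neg_iff_add_eq_0)
  have "1 / (y - 1) + 1 / (inverse y - 1) = -1" "1 / (y + 1) + 1 / (inverse y + 1) = 1"
  proof -
    have nz': "inverse y - 1 \<noteq> 0" "inverse y + 1 \<noteq> 0"
      using y(4,5) eq_neg_iff_add_eq_0[of "inverse y" 1] by simp_all
    have "(y - 1) * (inverse y - 1) = - ((y - 1) + (inverse y - 1))"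
      "(y + 1) * (inverse y + 1) = (y + 1) + (inverse y + 1)"
      using y(1) by (simp_all add: algebra_simps)
    moreover have "1 / a + 1 / b = (a + b) / (a * b)" if "a \<noteq> 0" "b \<noteq> 0" for a b :: complex
      using that by (simp add: add_frac_eq add.commute)
    ultimately show "1 / (y - 1) + 1 / (inverse y - 1) = -1" "1 / (y + 1) + 1 / (inverse y + 1) = 1"
      using nz nz' by (metis add_eq_0_iff divide_minus_right divide_self mult_eq_0_iff neg_equal_0_iff_equal)+
  qed
  then have r: "1 / (inverse y - 1) = -1 - 1 / (y - 1)" "1 / (inverse y + 1) = 1 - 1 / (y + 1)"
    by (simp_all add: algebra_simps)
  have alg: "a / 2 * p - b / 2 * q + h + (a / 2 * (-1 - p) - b / 2 * (1 - q) + h') =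
      h + h' - (a + b) / 2" for a b p q h h' :: complex
    by (simp add: field_simps)
  have "y \<in> ball 0 \<rho>" "inverse y \<in> ball 0 \<rho>" using assms by (simp_all add: norm_inverse)
  then show ?thesis
    unfolding *[OF \<open>y \<in> _\<close> y(2,3)] *[OF \<open>inverse y \<in> _\<close> y(4,5)] r by (intro alg)
qed

text \<open>
  The integrand is \<open>H(y) + H(y\<^sup>-\<^sup>1) - (E(1) + E(-1)) / 2\<close> with \<open>H\<close> holomorphic, so the mean value property
  gives \<open>2 H(0) - (E(1) + E(-1)) / 2\<close>, and \<open>E(0) = 0\<close> forces \<open>H(0) = (E(1) + E(-1)) / 2\<close>. This replaces a
  principal value computation of the two simple poles on the circle.
\<close>

lemma circle_integral_symmetrized:
  assumes E: "E holomorphic_on ball 0 \<rho>" "1 < \<rho>" "E 0 = 0"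
    and f: "f \<in> borel_measurable borel" and A: "finite A"
    and fE: "\<And>y. cmod y = 1 \<Longrightarrow> y \<notin> A \<Longrightarrow> y\<^sup>2 \<noteq> 1 \<Longrightarrow>
      f y = E y / (y\<^sup>2 - 1) + E (inverse y) / ((inverse y)\<^sup>2 - 1)"
  shows "(\<integral>y. f y \<partial>circle_measure) = (E 1 + E (-1)) / 2"
proof -
  obtain H where H: "H holomorphic_on ball 0 \<rho>"
    "\<And>y. y \<in> ball 0 \<rho> \<Longrightarrow> E y = (1 + y) / 2 * E 1 + (1 - y) / 2 * E (-1) + (y\<^sup>2 - 1) * H y"
    using split_off_poles[OF E(1,2)] by blast
  define c where "c = (E 1 + E (-1)) / 2"
  define G where "G = (\<lambda>\<theta>. H (cis (2 * pi * \<theta>)) + H (cis (2 * pi * (1 - \<theta>))) - c)"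
  have cH: "continuous_on {0..1} (\<lambda>\<theta>. H (cis (2 * pi * g \<theta>)))" if "continuous_on {0..1} g" for g
    by (rule continuous_on_compose2[OF holomorphic_on_imp_continuous_on[OF H(1)]])
       (use E(2) that in \<open>auto intro!: continuous_intros\<close>)
  have H0: "H 0 = c" using H(2)[of 0] E(2,3) by (simp add: c_def field_simps)
  have i1: "((\<lambda>\<theta>. H (cis (2 * pi * \<theta>))) has_integral c) {0..1}"
    using mean_value_has_integral[OF H(1) E(2)] H0 by simp
  have i2: "((\<lambda>\<theta>. H (cis (2 * pi * (1 - \<theta>)))) has_integral c) {0..1}"
  proof -
    have "(\<lambda>x::real. 1 - x) ` {0..1} = {0..1}" by (auto simp: image_iff intro: bexI[of _ "1 - _"])
    then show ?thesis
      using has_integral_affinity[of "\<lambda>\<theta>. H (cis (2 * pi * \<theta>))" c 0 1 "-1" 1] i1 by simp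
  qed
  have "(G has_integral c + c - c) {0..1}"
    unfolding G_def using has_integral_const_real[of c 0 1]
    by (intro has_integral_diff has_integral_add i1 i2) simp
  then have iG: "integral {0..1} G = c" by (simp add: integral_unique)
  have contG: "continuous_on {0..1} G"
    unfolding G_def by (intro continuous_on_diff continuous_on_add cH continuous_on_const) (auto intro!: continuous_intros)
  then have intG: "set_integrable lborel {0..1} G" by (rule borel_integrable_atLeastAtMost')
  have [measurable]: "f \<in> borel_measurable borel" by (rule f)
  have "(\<integral>y. f y \<partial>circle_measure) = (\<integral>\<theta>. f (cis (2 * pi * \<theta>)) \<partial>restrict_space lborel {0..1})"
    unfolding circle_measure_def by (rule integral_distr) measurable
  also have "\<dots> = (LINT \<theta>:{0..1}|lborel. f (cis (2 * pi * \<theta>)))"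
    by (simp add: integral_restrict_space set_lebesgue_integral_def)
  also have "\<dots> = (LINT \<theta>:{0..1}|lborel. G \<theta>)"
    unfolding set_lebesgue_integral_def
  proof (rule integral_cong_AE)
    have "(\<lambda>\<theta>::real. cis (2 * pi * \<theta>)) \<in> borel_measurable borel"
      by (intro borel_measurable_continuous_onI continuous_intros)
    then show "(\<lambda>\<theta>. indicat_real {0..1} \<theta> *\<^sub>R f (cis (2 * pi * \<theta>))) \<in> borel_measurable lborel"
      by measurable
    show "(\<lambda>\<theta>. indicat_real {0..1} \<theta> *\<^sub>R G \<theta>) \<in> borel_measurable lborel"
      using intG unfolding set_integrable_def by (rule borel_measurable_integrable)
    have "AE \<theta> in lborel. \<forall>b\<in>insert 1 (insert (-1) A). cis (2 * pi * \<theta>) \<noteq> b"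
      using A by (intro AE_finite_allI AE_cis_neq) auto
    then show "AE \<theta> in lborel. indicat_real {0..1} \<theta> *\<^sub>R f (cis (2 * pi * \<theta>)) = indicat_real {0..1} \<theta> *\<^sub>R G \<theta>"
    proof eventually_elim
      case (elim \<theta>)
      let ?y = "cis (2 * pi * \<theta>)"
      have y: "?y \<notin> A" "?y\<^sup>2 \<noteq> 1" using elim by (auto simp: power2_eq_1_iff)
      have "cis (2 * pi * (1 - \<theta>)) = cis (2 * pi) * cis (- (2 * pi * \<theta>))"
        by (simp only: cis_mult) (simp add: algebra_simps)
      then have "cis (2 * pi * (1 - \<theta>)) = inverse ?y" by simp
      then have "f ?y = G \<theta>"
        using fE[of ?y] y symmetrized_split[OF H(2) E(2), of ?y] by (simp add: G_def c_def)
      then show ?case by simp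
    qed
  qed
  also have "\<dots> = integral {0..1} G"
    by (rule set_borel_integral_eq_integral(2)[OF intG])
  finally show ?thesis using iG by (simp add: c_def)
qed

text \<open>
  A bound that depends on \<open>E\<close> only through its size on one circle of radius \<open>r > 1\<close>; it provides the
  integrability, uniformly in the other variables, that Fubini's theorem requires.
\<close>

lemma symmetrized_bound:
  assumes E: "E holomorphic_on ball 0 \<rho>" and r: "1 < r" "r < \<rho>"
    and C: "\<And>y. cmod y = r \<Longrightarrow> cmod (E y) \<le> C"
    and y: "cmod y = 1" "y\<^sup>2 \<noteq> 1"
  shows "cmod (E y / (y\<^sup>2 - 1) + E (inverse y) / ((inverse y)\<^sup>2 - 1)) \<le> C * (2 * (2 + r) / (r\<^sup>2 - 1) + 1)"
proof -
  have max: "cmod (F w) \<le> B" if F: "F holomorphic_on ball 0 \<rho>" "\<And>y. cmod y = r \<Longrightarrow> cmod (F y) \<le> B"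
    and w: "cmod w \<le> r" for F B w
  proof (rule maximum_modulus_frontier[of F "cball 0 r"])
    show "F holomorphic_on interior (cball 0 r)"
      by (rule holomorphic_on_subset[OF F(1)]) (use r in auto)
    show "continuous_on (closure (cball 0 r)) F"
      by (rule continuous_on_subset[OF holomorphic_on_imp_continuous_on[OF F(1)]]) (use r in auto)
    show "cmod (F z) \<le> B" if "z \<in> frontier (cball 0 r)" for z
      by (rule F(2)) (use that r in auto)
  qed (use w in auto)
  obtain H where H: "H holomorphic_on ball 0 \<rho>"
    "\<And>y. y \<in> ball 0 \<rho> \<Longrightarrow> E y = (1 + y) / 2 * E 1 + (1 - y) / 2 * E (-1) + (y\<^sup>2 - 1) * H y"
    using split_off_poles[OF E] r by auto
  have E1: "cmod (E 1) \<le> C" "cmod (E (-1)) \<le> C" using max[OF E C] r by auto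
  then have C0: "0 \<le> C" using norm_ge_zero order_trans by blast
  have r2: "1 < r\<^sup>2" using r by (simp add: one_less_power)
  \<comment> \<open>On \<open>\<bar>w\<bar> = r\<close> the linear part is at most \<open>(1 + r) C\<close> and \<open>\<bar>w\<^sup>2 - 1\<bar>\<close> at least \<open>r\<^sup>2 - 1\<close>.\<close>
  define K where "K = C * (2 + r) / (r\<^sup>2 - 1)"
  have HK: "cmod (H w) \<le> K" if w: "cmod w = r" for w
  proof -
    have "(w\<^sup>2 - 1) * H w = E w - (1 + w) / 2 * E 1 - (1 - w) / 2 * E (-1)"
      using H(2)[of w] w r by simp
    then have "cmod (w\<^sup>2 - 1) * cmod (H w) = cmod (E w - (1 + w) / 2 * E 1 - (1 - w) / 2 * E (-1))"
      by (simp flip: norm_mult)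
    also have "\<dots> \<le> cmod (E w) + cmod ((1 + w) / 2 * E 1) + cmod ((1 - w) / 2 * E (-1))"
      by (meson norm_triangle_ineq4 order_trans add_mono order_refl)
    also have "\<dots> \<le> C + (1 + r) / 2 * C + (1 + r) / 2 * C"
    proof (intro add_mono)
      show "cmod (E w) \<le> C" using C w by blast
      have "cmod (1 + w) \<le> 1 + r" "cmod (1 - w) \<le> 1 + r"
        using norm_triangle_ineq[of 1 w] norm_triangle_ineq4[of 1 w] w by auto
      then show "cmod ((1 + w) / 2 * E 1) \<le> (1 + r) / 2 * C" "cmod ((1 - w) / 2 * E (-1)) \<le> (1 + r) / 2 * C"
        unfolding norm_mult norm_divide using E1 r by (auto intro!: mult_mono divide_right_mono)
    qed
    also have "\<dots> = C * (2 + r)" by (simp add: field_simps)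
    finally have "cmod (w\<^sup>2 - 1) * cmod (H w) \<le> C * (2 + r)" .
    moreover have "r\<^sup>2 - 1 \<le> cmod (w\<^sup>2 - 1)"
      using norm_triangle_ineq2[of "w\<^sup>2" 1] w by (simp add: norm_power)
    then have "(r\<^sup>2 - 1) * cmod (H w) \<le> cmod (w\<^sup>2 - 1) * cmod (H w)"
      by (rule mult_right_mono) simp
    ultimately have "(r\<^sup>2 - 1) * cmod (H w) \<le> C * (2 + r)" by linarith
    then show ?thesis using r2 by (simp add: K_def pos_le_divide_eq mult.commute)
  qed
  have y': "cmod (inverse y) = 1" using y by (simp add: norm_inverse)
  have "cmod (E y / (y\<^sup>2 - 1) + E (inverse y) / ((inverse y)\<^sup>2 - 1)) =
      cmod (H y + H (inverse y) - (E 1 + E (-1)) / 2)"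
    using symmetrized_split[OF H(2) _ y] r by simp
  also have "\<dots> \<le> cmod (H y) + cmod (H (inverse y)) + cmod ((E 1 + E (-1)) / 2)"
    by (meson norm_triangle_ineq4 norm_triangle_ineq order_trans add_mono order_refl)
  also have "\<dots> \<le> K + K + C"
  proof (intro add_mono)
    show "cmod (H y) \<le> K" "cmod (H (inverse y)) \<le> K" using max[OF H(1) HK] y y' r by auto
    show "cmod ((E 1 + E (-1)) / 2) \<le> C"
      using norm_triangle_ineq[of "E 1" "E (-1)"] E1 by (simp add: norm_divide)
  qed
  also have "\<dots> = C * (2 * (2 + r) / (r\<^sup>2 - 1) + 1)"
    by (simp add: K_def field_simps)
  finally show ?thesis .
qed

section \<open>Generic points of the torus\<close>

abbreviation torus_measure :: "nat set \<Rightarrow> (nat \<Rightarrow> complex) measure" where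
  "torus_measure K \<equiv> (\<Pi>\<^sub>M i\<in>K. circle_measure)"

lemma product_sigma_finite_circle: "product_sigma_finite (\<lambda>_::nat. circle_measure)"
  by (simp add: product_sigma_finite_def prob_space_imp_sigma_finite prob_space_circle_measure)

lemma prob_space_torus: "prob_space (torus_measure K)"
  by (rule prob_space_PiM) (rule prob_space_circle_measure)

lemma measurable_torus_component: "i \<in> K \<Longrightarrow> (\<lambda>x. x i) \<in> borel_measurable (torus_measure K)"
  using measurable_component_singleton[of i K "\<lambda>_. circle_measure"]
  by (simp add: measurable_cong_sets[OF refl sets_circle_measure])

lemma AE_torus_norm: "i \<in> K \<Longrightarrow> AE x in torus_measure K. cmod (x i) = 1"
  by (rule AE_PiM_component[OF prob_space_circle_measure _ AE_circle_measure_norm])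

text \<open>
  The graph of a function of the other coordinates is a null set, since a single point of the circle is one.
\<close>

lemma AE_torus_neq:
  assumes K: "finite K" "i \<in> K" and h: "h \<in> borel_measurable (torus_measure (K - {i}))"
  shows "AE x in torus_measure K. x i \<noteq> h (restrict x (K - {i}))"
proof -
  let ?K = "K - {i}"
  have iK: "insert i ?K = K" using K by auto
  have r: "(\<lambda>x. restrict x ?K) \<in> measurable (torus_measure K) (torus_measure ?K)"
    by (rule measurable_restrict_subset) auto
  have m1: "(\<lambda>x. h (restrict x ?K)) \<in> borel_measurable (torus_measure K)"
    by (rule measurable_compose[OF r h])
  have m2: "(\<lambda>x. x i) \<in> borel_measurable (torus_measure K)" by (rule measurable_torus_component[OF K(2)])
  let ?S = "{x \<in> space (torus_measure K). x i - h (restrict x ?K) \<in> {0}}"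
  have S: "?S \<in> sets (torus_measure K)"
    by (rule measurable_sets_Collect[of _ _ borel "\<lambda>v. v \<in> {0}"])
       (rule borel_measurable_diff[OF m2 m1], use borel_singleton[of "{}" "0::complex"] in simp)
  have "emeasure (torus_measure K) ?S = (\<integral>\<^sup>+x. indicator ?S x \<partial>torus_measure (insert i ?K))"
    unfolding iK by (rule nn_integral_indicator[OF S, symmetric])
  also have "\<dots> = (\<integral>\<^sup>+x. (\<integral>\<^sup>+y. indicator ?S (x(i := y)) \<partial>circle_measure) \<partial>torus_measure ?K)"
    by (rule product_sigma_finite.product_nn_integral_insert[OF product_sigma_finite_circle])
       (use K(1) in simp, simp, unfold iK, rule borel_measurable_indicator[OF S])
  also have "\<dots> = (\<integral>\<^sup>+x. 0 \<partial>torus_measure ?K)"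
  proof (rule nn_integral_cong)
    fix x assume x: "x \<in> space (torus_measure ?K)"
    have "restrict (x(i := y)) ?K = x" for y
      using x by (auto simp: space_PiM PiE_def extensional_def restrict_def)
    then have "AE y in circle_measure. indicator ?S (x(i := y)) = (0::ennreal)"
      using AE_circle_measure_neq[of "h x"] by (auto simp: indicator_def elim!: eventually_mono)
    then have "(\<integral>\<^sup>+y. indicator ?S (x(i := y)) \<partial>circle_measure) = (\<integral>\<^sup>+y. 0 \<partial>circle_measure)"
      by (rule nn_integral_cong_AE)
    then show "(\<integral>\<^sup>+y. indicator ?S (x(i := y)) \<partial>circle_measure) = 0" by simp
  qed
  finally have "?S \<in> null_sets (torus_measure K)" using S by (auto simp: null_sets_def)
  then show ?thesis by (rule AE_I') auto
qed

datatype letter = Var nat | Inv nat | Fix complex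

fun letter_val :: "(nat \<Rightarrow> complex) \<Rightarrow> letter \<Rightarrow> complex" where
  "letter_val x (Var i) = x i"
| "letter_val x (Inv i) = inverse (x i)"
| "letter_val x (Fix c) = c"

definition letters :: "complex set \<Rightarrow> nat set \<Rightarrow> letter set" where
  "letters F K = Fix ` F \<union> (Var ` K \<union> Inv ` K)"

text \<open>
  The conditions that make all letters distinct, for any set of fixed letters contained in \<open>{1, -1}\<close>.
\<close>

definition generic :: "nat set \<Rightarrow> (nat \<Rightarrow> complex) \<Rightarrow> bool" where
  "generic K x \<longleftrightarrow> (\<forall>i\<in>K. cmod (x i) = 1 \<and> x i \<noteq> 1 \<and> x i \<noteq> -1) \<and>
     (\<forall>i\<in>K. \<forall>j\<in>K. i \<noteq> j \<longrightarrow> x i \<noteq> x j \<and> x i \<noteq> inverse (x j))"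

lemma AE_generic:
  assumes "finite K"
  shows "AE x in torus_measure K. generic K x"
proof -
  have "AE x in torus_measure K. \<forall>i\<in>K. cmod (x i) = 1 \<and> x i \<noteq> 1 \<and> x i \<noteq> -1"
  proof (rule AE_finite_allI[OF assms])
    fix i assume i: "i \<in> K"
    show "AE x in torus_measure K. cmod (x i) = 1 \<and> x i \<noteq> 1 \<and> x i \<noteq> -1"
      using AE_torus_norm[OF i] AE_torus_neq[OF assms i, of "\<lambda>_. 1"] AE_torus_neq[OF assms i, of "\<lambda>_. -1"]
      by auto
  qed
  moreover have "AE x in torus_measure K. \<forall>i\<in>K. \<forall>j\<in>K. i \<noteq> j \<longrightarrow> x i \<noteq> x j \<and> x i \<noteq> inverse (x j)"
  proof (intro AE_finite_allI[OF assms])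
    fix i j assume ij: "i \<in> K" "j \<in> K"
    show "AE x in torus_measure K. i \<noteq> j \<longrightarrow> x i \<noteq> x j \<and> x i \<noteq> inverse (x j)"
    proof (cases "i = j")
      case False
      then have j: "j \<in> K - {i}" using ij by auto
      have "(\<lambda>x. inverse (x j)) \<in> borel_measurable (torus_measure (K - {i}))"
        by (intro borel_measurable_inverse measurable_torus_component[OF j])
      from AE_torus_neq[OF assms ij(1) measurable_torus_component[OF j]] AE_torus_neq[OF assms ij(1) this]
      show ?thesis using j by auto
    qed simp
  qed
  ultimately show ?thesis unfolding generic_def by eventually_elim blast
qed

lemma generic_subset: "generic K x \<Longrightarrow> K' \<subseteq> K \<Longrightarrow> generic K' x"
  unfolding generic_def by blast

lemma self_inverse_iff: "(y::complex) = inverse y \<Longrightarrow> y \<noteq> 0 \<Longrightarrow> y = 1 \<or> y = -1"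
  by (metis left_inverse power2_eq_1_iff power2_eq_square)

lemma generic_letters:
  assumes "generic K x" "F \<subseteq> {1, -1}"
  shows "inj_on (letter_val x) (letters F K)"
    and "a \<in> letters F K \<Longrightarrow> cmod (letter_val x a) = 1"
proof -
  have g: "cmod (x i) = 1" "x i \<noteq> 0" "x i \<noteq> 1" "x i \<noteq> -1" "x i \<noteq> inverse (x i)"
    "inverse (x i) \<noteq> 1" "inverse (x i) \<noteq> -1" if "i \<in> K" for i
  proof -
    show a: "cmod (x i) = 1" "x i \<noteq> 0" "x i \<noteq> 1" "x i \<noteq> -1"
      using assms(1) that by (auto simp: generic_def)
    show "x i \<noteq> inverse (x i)" using self_inverse_iff[of "x i"] a by blast
    show "inverse (x i) \<noteq> 1" "inverse (x i) \<noteq> -1" using a by (metis inverse_inverse_eq inverse_1 inverse_minus_eq)+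
  qed
  have g2: "x i \<noteq> x j" "x i \<noteq> inverse (x j)" if "i \<in> K" "j \<in> K" "i \<noteq> j" for i j
    using assms(1) that by (auto simp: generic_def)
  show "inj_on (letter_val x) (letters F K)"
  proof (rule inj_onI)
    fix a b assume ab: "a \<in> letters F K" "b \<in> letters F K" "letter_val x a = letter_val x b"
    have "c \<noteq> x i" "c \<noteq> inverse (x i)" if "c \<in> F" "i \<in> K" for c i
      using g[OF that(2)] that assms(2) by auto
    moreover have "x i \<noteq> inverse (x j)" if "i \<in> K" "j \<in> K" for i j
      using g[of i] g2[of i j] that by (cases "i = j") auto
    ultimately show "a = b" using ab g2
      by (auto simp: letters_def) (metis inverse_inverse_eq)+
  qed
  show "cmod (letter_val x a) = 1" if "a \<in> letters F K"
    using that g assms(2) by (auto simp: letters_def norm_inverse)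
qed

lemma finite_letters [simp]: "finite F \<Longrightarrow> finite K \<Longrightarrow> finite (letters F K)"
  by (simp add: letters_def)

lemma prod_letters:
  assumes "finite F" "finite K"
  shows "(\<Prod>a\<in>letters F K. h a) = (\<Prod>f\<in>F. h (Fix f)) * (\<Prod>i\<in>K. h (Var i) * h (Inv i))"
  unfolding letters_def using assms
  by - (subst prod.union_disjoint, simp, simp, blast,
      subst prod.union_disjoint, simp, simp, blast,
      simp add: prod.reindex inj_on_def prod.distrib)

lemma sum_letters:
  assumes "finite F" "finite K"
  shows "(\<Sum>a\<in>letters F K. h a) = (\<Sum>f\<in>F. h (Fix f)) + (\<Sum>i\<in>K. h (Var i) + h (Inv i))"
  unfolding letters_def using assms
  by - (subst sum.union_disjoint, simp, simp, blast,
      subst sum.union_disjoint, simp, simp, blast,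
      simp add: sum.reindex inj_on_def sum.distrib)

lemma letters_remove_Fix: "letters F K - {Fix c} = letters (F - {c}) K"
  by (auto simp: letters_def)

lemma letters_remove_Var: "j \<in> K \<Longrightarrow> letters F K - {Var j} = insert (Inv j) (letters F (K - {j}))"
  by (auto simp: letters_def)

lemma letters_remove_Inv: "j \<in> K \<Longrightarrow> letters F K - {Inv j} = insert (Var j) (letters F (K - {j}))"
  by (auto simp: letters_def)

lemma letters_insert_Fix: "letters (insert c F) K = insert (Fix c) (letters F K)"
  by (auto simp: letters_def)

lemma letter_val_measurable:
  "a \<in> letters F K \<Longrightarrow> (\<lambda>x. letter_val x a) \<in> borel_measurable (torus_measure K)"
  by (auto simp: letters_def intro!: borel_measurable_inverse measurable_torus_component)

section \<open>Weights and integrands\<close>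

text \<open>
  \<open>theta t y u\<close> is \<open>(1 - uy)(1 - u/y) / ((1 - tuy)(1 - tu/y))\<close>, the factor of the density that couples
  \<open>y, y\<^sup>-\<^sup>1\<close> with a letter \<open>u\<close>.
\<close>

definition theta :: "complex \<Rightarrow> complex \<Rightarrow> complex \<Rightarrow> complex" where
  "theta t y u = one_minus_pm u y / one_minus_pm (t * u) y"

text \<open>
  The density without its constant. For \<open>F = {1, -1}\<close> it is the Koornwinder density with
  \<open>t, -t, \<surd>t, -\<surd>t\<close>, for \<open>F = {}\<close> the one with \<open>1, -1, \<surd>t, -\<surd>t\<close>: passing from \<open>F\<close> to \<open>F - {c}\<close>
  replaces the parameter \<open>tc\<close> by \<open>c\<close>.
\<close>

definition weight :: "complex \<Rightarrow> complex set \<Rightarrow> nat set \<Rightarrow> (nat \<Rightarrow> complex) \<Rightarrow> complex" where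
  "weight t F K x = (\<Prod>i\<in>K. (\<Prod>f\<in>F. theta t (x i) f) / one_minus_pm t ((x i)\<^sup>2)) *
     (\<Prod>(i, j)\<in>{(i, j). i \<in> K \<and> j \<in> K \<and> i < j}. one_minus_pm2 1 (x i) (x j) / one_minus_pm2 t (x i) (x j))"

lemma finite_pairs [simp]: "finite K \<Longrightarrow> finite {(i, j). i \<in> K \<and> j \<in> K \<and> P i j}"
  by (rule finite_subset[of _ "K \<times> K"]) auto

lemma one_minus_pm2_theta: "one_minus_pm2 1 y z / one_minus_pm2 t y z = theta t y z * theta t y (inverse z)"
  by (simp add: one_minus_pm2_def theta_def one_minus_pm_def mult_ac)

lemma one_minus_pm2_commute: "one_minus_pm2 t y z = one_minus_pm2 t z y"
  by (simp add: one_minus_pm2_def mult_ac)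

text \<open>
  The variable \<open>x\<^sub>j\<close> is coupled with all other letters, variable or fixed, in the same way.
\<close>

lemma weight_remove:
  assumes K: "finite K" "j \<in> K" and F: "finite F"
  shows "weight t F K x = weight t F (K - {j}) x *
    (1 / one_minus_pm t ((x j)\<^sup>2) * (\<Prod>a\<in>letters F (K - {j}). theta t (x j) (letter_val x a)))"
proof -
  let ?K = "K - {j}"
  define g where "g = (\<lambda>i j. one_minus_pm2 1 (x i) (x j) / one_minus_pm2 t (x i) (x j))"
  have gc: "g i i' = g i' i" for i i' by (simp add: g_def one_minus_pm2_commute)
  have eq: "{(i, i'). i \<in> K \<and> i' \<in> K \<and> i < i'} =
      {(i, i'). i \<in> ?K \<and> i' \<in> ?K \<and> i < i'} \<union>
      ((\<lambda>i. (i, j)) ` {i\<in>?K. i < j} \<union> (\<lambda>i. (j, i)) ` {i\<in>?K. \<not> i < j})"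
    using K by auto
  have "(\<Prod>(i, i')\<in>{(i, i'). i \<in> K \<and> i' \<in> K \<and> i < i'}. g i i') =
      (\<Prod>(i, i')\<in>{(i, i'). i \<in> ?K \<and> i' \<in> ?K \<and> i < i'}. g i i') *
      ((\<Prod>i\<in>{i\<in>?K. i < j}. g j i) * (\<Prod>i\<in>{i\<in>?K. \<not> i < j}. g j i))"
  proof -
    have "finite {(i, i'). i \<in> ?K \<and> i' \<in> ?K \<and> i < i'}" "finite {i\<in>?K. i < j}" "finite {i\<in>?K. \<not> i < j}"
      using K(1) finite_pairs[of ?K] by simp_all
    moreover have "{(i, i'). i \<in> ?K \<and> i' \<in> ?K \<and> i < i'} \<inter>
        ((\<lambda>i. (i, j)) ` {i\<in>?K. i < j} \<union> (\<lambda>i. (j, i)) ` {i\<in>?K. \<not> i < j}) = {}"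
      "(\<lambda>i. (i, j)) ` {i\<in>?K. i < j} \<inter> (\<lambda>i. (j, i)) ` {i\<in>?K. \<not> i < j} = {}"
      by auto
    moreover have "(\<Prod>(i, i')\<in>(\<lambda>i. (i, j)) ` {i\<in>?K. i < j}. g i i') = (\<Prod>i\<in>{i\<in>?K. i < j}. g j i)"
      "(\<Prod>(i, i')\<in>(\<lambda>i. (j, i)) ` {i\<in>?K. \<not> i < j}. g i i') = (\<Prod>i\<in>{i\<in>?K. \<not> i < j}. g j i)"
      by (simp_all add: prod.reindex inj_on_def gc[of _ j])
    ultimately show ?thesis
      unfolding eq by (simp only: prod.union_disjoint finite_UnI finite_imageI)
  qed
  also have "(\<Prod>i\<in>{i\<in>?K. i < j}. g j i) * (\<Prod>i\<in>{i\<in>?K. \<not> i < j}. g j i) = (\<Prod>i\<in>?K. g j i)"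
    using K by (subst prod.union_disjoint[symmetric]) (auto intro!: prod.cong)
  also have "(\<Prod>i\<in>?K. g j i) = (\<Prod>i\<in>?K. theta t (x j) (x i) * theta t (x j) (inverse (x i)))"
    by (simp add: g_def one_minus_pm2_theta)
  finally show ?thesis
    unfolding weight_def g_def using K F
    by (simp add: prod_letters prod.remove[OF K] del: insert_Diff_single) 
qed

lemma weight_insert:
  assumes "finite K" "finite F" "c \<notin> F"
  shows "weight t (insert c F) K x = weight t F K x * (\<Prod>i\<in>K. theta t (x i) c)"
  unfolding weight_def using assms by (simp add: prod_dividef prod.distrib)

lemma weight_cong: "(\<And>i. i \<in> K \<Longrightarrow> x i = x' i) \<Longrightarrow> weight t F K x = weight t F K x'"
  unfolding weight_def by (intro arg_cong2[where f = "(*)"] prod.cong) auto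

lemma one_minus_pm_measurable [measurable]:
  "f \<in> borel_measurable M \<Longrightarrow> (\<lambda>x. one_minus_pm c (f x)) \<in> borel_measurable M"
  unfolding one_minus_pm_def
  by (intro borel_measurable_times borel_measurable_diff borel_measurable_const borel_measurable_inverse)

lemma theta_measurable [measurable]:
  "f \<in> borel_measurable M \<Longrightarrow> (\<lambda>x. theta t (f x) u) \<in> borel_measurable M"
  unfolding theta_def by (intro borel_measurable_divide one_minus_pm_measurable)

lemma one_minus_pm2_measurable [measurable]:
  fixes f g :: "'a \<Rightarrow> complex"
  shows "f \<in> borel_measurable M \<Longrightarrow> g \<in> borel_measurable M \<Longrightarrow> (\<lambda>x. one_minus_pm2 c (f x) (g x)) \<in> borel_measurable M"
  unfolding one_minus_pm2_def
  by (intro borel_measurable_times borel_measurable_diff borel_measurable_const borel_measurable_inverse)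

lemma weight_measurable: "weight t F K \<in> borel_measurable (torus_measure K)"
  unfolding weight_def split_def
  by (intro borel_measurable_times borel_measurable_prod borel_measurable_divide theta_measurable
       one_minus_pm_measurable one_minus_pm2_measurable borel_measurable_power measurable_torus_component) auto

lemma one_minus_pm_upper: "cmod u \<le> 1 \<Longrightarrow> cmod y = 1 \<Longrightarrow> cmod (one_minus_pm u y) \<le> 4"
proof -
  assume u: "cmod u \<le> 1" "cmod y = 1"
  have "cmod (1 - u * w) \<le> 2" if "cmod w = 1" for w
    using norm_triangle_ineq4[of 1 "u * w"] u that by (simp add: norm_mult)
  from mult_mono[OF this[OF u(2)] this[of "inverse y"]] u show ?thesis
    by (simp add: one_minus_pm_def norm_mult norm_inverse)
qed

lemma one_minus_pm_lower:
  assumes "cmod u \<le> cmod t" "cmod t < 1" "cmod y = 1"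
  shows "(1 - cmod t)\<^sup>2 \<le> cmod (one_minus_pm u y)"
proof -
  have "1 - cmod t \<le> cmod (1 - u * w)" if "cmod w = 1" for w
    using norm_triangle_ineq2[of 1 "u * w"] assms that by (simp add: norm_mult)
  from mult_mono[OF this[of y] this[of "inverse y"]] assms show ?thesis
    by (simp add: one_minus_pm_def norm_mult norm_inverse power2_eq_square)
qed

lemma theta_bound:
  assumes "cmod t < 1" "cmod u = 1" "cmod y = 1"
  shows "cmod (theta t y u) \<le> 4 / (1 - cmod t)\<^sup>2"
  using one_minus_pm_upper[of u y] one_minus_pm_lower[of "t * u" t y] assms
  by (auto simp: theta_def norm_divide norm_mult intro!: frac_le)

lemma norm_prod_bound:
  fixes f :: "'a \<Rightarrow> complex"
  assumes "\<And>i. i \<in> A \<Longrightarrow> cmod (f i) \<le> c"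
  shows "cmod (\<Prod>i\<in>A. f i) \<le> c ^ card A"
proof -
  have "cmod (\<Prod>i\<in>A. f i) \<le> (\<Prod>i\<in>A. c)"
    by (rule order_trans[OF norm_prod_le]) (intro prod_mono, use assms in auto)
  then show ?thesis by simp
qed

lemma weight_bounded:
  assumes t: "cmod t < 1" and F: "F \<subseteq> {1, -1}"
  shows "\<exists>C. \<forall>x. (\<forall>i\<in>K. cmod (x i) = 1) \<longrightarrow> cmod (weight t F K x) \<le> C"
proof -
  let ?q = "4 / (1 - cmod t)\<^sup>2"
  let ?S = "{(i, j). i \<in> K \<and> j \<in> K \<and> i < j}"
  have "cmod (weight t F K x) \<le> (?q ^ card F / (1 - cmod t)\<^sup>2) ^ card K * (?q * ?q) ^ card ?S"
    if x: "\<forall>i\<in>K. cmod (x i) = 1" for x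
    unfolding weight_def norm_mult
  proof (intro mult_mono norm_prod_bound)
    fix i assume i: "i \<in> K"
    have "cmod (\<Prod>f\<in>F. theta t (x i) f) \<le> ?q ^ card F"
      by (rule norm_prod_bound, rule theta_bound) (use t F x i in auto)
    moreover have "(1 - cmod t)\<^sup>2 \<le> cmod (one_minus_pm t ((x i)\<^sup>2))"
      by (rule one_minus_pm_lower) (use t x i in \<open>auto simp: norm_power\<close>)
    ultimately show "cmod ((\<Prod>f\<in>F. theta t (x i) f) / one_minus_pm t ((x i)\<^sup>2)) \<le> ?q ^ card F / (1 - cmod t)\<^sup>2"
      unfolding norm_divide using t by (intro frac_le) auto
  next
    fix p assume "p \<in> ?S"
    then obtain i j where p: "p = (i, j)" "i \<in> K" "j \<in> K" by auto
    have "cmod (theta t (x i) (x j) * theta t (x i) (inverse (x j))) \<le> ?q * ?q"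
      unfolding norm_mult by (intro mult_mono theta_bound) (use t x p in \<open>auto simp: norm_inverse\<close>)
    then show "cmod (case p of (i, j) \<Rightarrow> one_minus_pm2 1 (x i) (x j) / one_minus_pm2 t (x i) (x j)) \<le> ?q * ?q"
      by (simp add: p one_minus_pm2_theta)
  qed (use t in auto)
  then show ?thesis by blast
qed

definition hl_integrand ::
    "complex \<Rightarrow> complex \<Rightarrow> complex set \<Rightarrow> nat set \<Rightarrow> nat list \<Rightarrow> (nat \<Rightarrow> complex) \<Rightarrow> complex" where
  "hl_integrand t \<alpha> F K lam x = weight t F K x * hl_sum t \<alpha> lam (letters F K) (letter_val x)"

lemma integrable_torusI:
  fixes f :: "(nat \<Rightarrow> complex) \<Rightarrow> complex"
  assumes "finite K" "f \<in> borel_measurable (torus_measure K)" "\<And>x. generic K x \<Longrightarrow> cmod (f x) \<le> C"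
  shows "integrable (torus_measure K) f"
proof -
  interpret prob_space "torus_measure K" by (rule prob_space_torus)
  show ?thesis
    by (rule integrable_const_bound[of f C]) (use AE_generic[OF assms(1)] assms(2,3) in \<open>auto elim: eventually_mono\<close>)
qed

lemma hl_integrand_integrable:
  assumes "cmod t < 1" "F \<subseteq> {1, -1}" "finite K"
  shows "integrable (torus_measure K) (hl_integrand t \<alpha> F K lam)"
proof -
  have F: "finite F" using assms(2) finite_subset by auto
  obtain C1 where C1: "\<And>x. (\<forall>i\<in>K. cmod (x i) = 1) \<Longrightarrow> cmod (weight t F K x) \<le> C1"
    using weight_bounded[OF assms(1,2)] by blast
  obtain Q where Q: "polyf (letters F K) Q"
    "\<And>z. inj_on z (letters F K) \<Longrightarrow> (\<forall>a\<in>letters F K. cmod (z a) \<le> 1) \<Longrightarrow> hl_sum t \<alpha> lam (letters F K) z = Q z"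
    using hl_sum_polyf[of "letters F K" 1 t \<alpha> lam] F assms(3) by auto
  obtain C2 where C2: "\<And>z. (\<forall>a\<in>letters F K. cmod (z a) \<le> 1) \<Longrightarrow> cmod (Q z) \<le> C2"
    using polyf_bounded[OF Q(1), of 1] by blast
  show ?thesis
  proof (rule integrable_torusI[OF assms(3)])
    show "hl_integrand t \<alpha> F K lam \<in> borel_measurable (torus_measure K)"
      unfolding hl_integrand_def
      by (intro borel_measurable_times weight_measurable hl_sum_measurable letter_val_measurable)
    fix x assume x: "generic K x"
    note v = generic_letters[OF x assms(2)]
    have "cmod (hl_sum t \<alpha> lam (letters F K) (letter_val x)) \<le> C2"
      using Q(2)[OF v(1)] C2[of "letter_val x"] v(2) by simp
    moreover have "cmod (weight t F K x) \<le> C1" using C1 x by (auto simp: generic_def)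
    ultimately show "cmod (hl_integrand t \<alpha> F K lam x) \<le> C1 * C2"
      unfolding hl_integrand_def norm_mult by (intro mult_mono') auto
  qed
qed

section \<open>The contribution of a given first letter\<close>

lemma theta_inverse: "theta t (inverse y) u = theta t y u"
  by (simp add: theta_def one_minus_pm_def mult.commute)

lemma one_minus_pm_inverse: "one_minus_pm t (inverse y) = one_minus_pm t y"
  by (simp add: one_minus_pm_def mult.commute)

lemma one_minus_neq_0: "cmod w < 1 \<Longrightarrow> 1 - w \<noteq> 0"
  by auto

text \<open>
  A fixed letter in first place cancels its own share of the weight.
\<close>

lemma theta_fixed_letter:
  assumes "c \<in> {1, -1}" "cmod t < 1" "cmod y = 1" "y \<noteq> c"
  shows "theta t y c * ((c - t * y) / (c - y) * ((c - t * inverse y) / (c - inverse y))) = 1"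
proof -
  have cc: "c * c = 1" "inverse c = c" using assms(1) by auto
  have *: "c - w = c * (1 - c * w)" for w using cc(1) by (simp add: right_diff_distrib flip: mult.assoc)
  have f: "(c - t * w) / (c - w) = (1 - t * c * w) / (1 - c * w)" for w
    using cc by (subst *[of w], subst *[of "t * w"]) (auto simp: mult_ac)
  have n1: "1 - c * w \<noteq> 0" if "w \<noteq> c" for w
    using *[of w] that by auto
  have n2: "1 - t * c * w \<noteq> 0" if "cmod w = 1" for w
    by (rule one_minus_neq_0) (use assms that in \<open>auto simp: norm_mult\<close>)
  have "inverse y \<noteq> c" using assms(4) cc(2) by (metis inverse_inverse_eq)
  then show ?thesis
    unfolding f theta_def one_minus_pm_def
    using n1[of y] n1[of "inverse y"] n2[of y] n2[of "inverse y"] assms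
    by (simp add: norm_inverse)
qed

text \<open>
  A variable letter in first place cancels the half of the coupling that is singular inside the unit disc.
\<close>

lemma theta_first_letter:
  assumes "cmod t < 1" "cmod y = 1" "cmod u = 1" "y \<noteq> u"
  shows "theta t y u * ((y - t * u) / (y - u)) = (1 - u * y) / (1 - t * u * y)"
proof -
  have y0: "y \<noteq> 0" using assms by auto
  have "y - w = y * (1 - w * inverse y)" for w using y0 by (simp add: field_simps)
  from this[of u] this[of "t * u"]
  have f: "(y - t * u) / (y - u) = (1 - t * u * inverse y) / (1 - u * inverse y)"
    and n: "1 - u * inverse y \<noteq> 0"
    using y0 assms(4) by auto
  have n2: "1 - t * u * inverse y \<noteq> 0"
    by (rule one_minus_neq_0) (use assms in \<open>auto simp: norm_mult norm_inverse\<close>)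
  show ?thesis
    unfolding f theta_def one_minus_pm_def using n n2 by simp
qed

text \<open>
  The numerator \<open>E(y)\<close> of the term with first letter \<open>y\<close>, where \<open>U\<close> consists of the letters other than
  \<open>y\<close> and \<open>y\<^sup>-\<^sup>1\<close>; the factor \<open>1 / (y\<^sup>2 - 1)\<close> from the pair \<open>y, y\<^sup>-\<^sup>1\<close> is kept separate.
\<close>

definition peel_kernel :: "complex \<Rightarrow> complex \<Rightarrow> nat \<Rightarrow> nat list \<Rightarrow> complex set \<Rightarrow> complex \<Rightarrow> complex" where
  "peel_kernel t \<alpha> l ls U y = y ^ (l + 2) * (1 - \<alpha> * y) / (1 - t * y\<^sup>2) *
     (\<Prod>u\<in>U. (1 - u * y) / (1 - t * u * y)) * hl_sum t \<alpha> ls (insert (inverse y) U) (\<lambda>u. u)"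

definition letter_term :: "complex \<Rightarrow> complex \<Rightarrow> complex set \<Rightarrow> nat set \<Rightarrow> nat \<Rightarrow> nat list \<Rightarrow> letter \<Rightarrow> (nat \<Rightarrow> complex) \<Rightarrow> complex" where
  "letter_term t \<alpha> F K l ls a x = weight t F K x * (letter_val x a ^ l * (1 - \<alpha> * letter_val x a) *
     (\<Prod>b\<in>letters F K - {a}. (letter_val x a - t * letter_val x b) / (letter_val x a - letter_val x b)) *
     hl_sum t \<alpha> ls (letters F K - {a}) (letter_val x))"

lemma letter_term_variable:
  assumes t: "cmod t < 1" and F: "F \<subseteq> {1, -1}" and K: "finite K" "j \<in> K" and x: "generic K x"
    and a: "a = Var j \<or> a = Inv j"
  defines "U \<equiv> letter_val x ` letters F (K - {j})"
  shows "letter_term t \<alpha> F K l ls a x = weight t F (K - {j}) x *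
    (peel_kernel t \<alpha> l ls U (letter_val x a) / ((letter_val x a)\<^sup>2 - 1))"
proof -
  let ?J = "letters F (K - {j})" and ?v = "letter_val x"
  define y where "y = ?v a"
  have finF: "finite F" using F finite_subset by auto
  obtain a' where a': "letters F K - {a} = insert a' ?J" "?v a' = inverse y" "a' \<notin> ?J" "a \<notin> ?J" "a \<in> letters F K"
    "a' \<in> letters F K"
  proof (cases "a = Var j")
    case True
    then show thesis
      using K(2) by (intro that[of "Inv j"]) (auto simp: letters_remove_Var y_def letters_def)
  next
    case False
    then have "a = Inv j" using a by simp
    then show thesis
      using K(2) by (intro that[of "Var j"]) (auto simp: letters_remove_Inv y_def letters_def)
  qed
  have xj: "cmod (x j) = 1" "x j \<noteq> 1" "x j \<noteq> -1" using x K by (auto simp: generic_def)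
  have y: "cmod y = 1" "y \<noteq> 0" "y\<^sup>2 \<noteq> 1" "y\<^sup>2 - 1 \<noteq> 0"
    using a xj by (auto simp: y_def norm_inverse power2_eq_1_iff inverse_eq_iff_eq[of "x j" "-1", simplified])
  note v = generic_letters[OF x F]
  have sub: "?J \<subseteq> letters F K" by (auto simp: letters_def)
  have injJ: "inj_on ?v ?J" by (rule inj_on_subset[OF v(1) sub])
  have U: "cmod u = 1" "y \<noteq> u" if "u \<in> U" for u
    using that v sub a' inj_onD[OF v(1), of a] by (auto simp: U_def y_def)
  have w: "weight t F K x = weight t F (K - {j}) x * (1 / one_minus_pm t (y\<^sup>2) * (\<Prod>u\<in>U. theta t y u))"
  proof -
    have "1 / one_minus_pm t ((x j)\<^sup>2) * (\<Prod>b\<in>?J. theta t (x j) (?v b)) =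
        1 / one_minus_pm t (y\<^sup>2) * (\<Prod>b\<in>?J. theta t y (?v b))"
      using a by (auto simp: y_def theta_inverse one_minus_pm_inverse power_inverse)
    then show ?thesis
      unfolding weight_remove[OF K finF] U_def by (simp add: prod.reindex[OF injJ])
  qed
  have p: "(\<Prod>b\<in>letters F K - {a}. (y - t * ?v b) / (y - ?v b)) =
      (y - t * inverse y) / (y - inverse y) * (\<Prod>u\<in>U. (y - t * u) / (y - u))"
    unfolding a'(1) using a'(2,3) K finF by (simp add: U_def prod.reindex[OF injJ])
  have h: "hl_sum t \<alpha> ls (letters F K - {a}) ?v = hl_sum t \<alpha> ls (insert (inverse y) U) (\<lambda>u. u)"
  proof -
    have "inj_on ?v (insert a' ?J)" by (rule inj_on_subset[OF v(1)]) (use a' sub in auto)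
    from hl_sum_image[OF this, of t \<alpha> ls] show ?thesis by (simp add: a' U_def)
  qed
  have q: "1 / one_minus_pm t (y\<^sup>2) * ((y - t * inverse y) / (y - inverse y)) = y\<^sup>2 / ((y\<^sup>2 - 1) * (1 - t * y\<^sup>2))"
  proof -
    have "cmod (t * y\<^sup>2) < 1" "cmod (t * inverse (y\<^sup>2)) < 1"
      using t y by (auto simp: norm_mult norm_power norm_inverse)
    then have nz: "1 - t * y\<^sup>2 \<noteq> 0" "1 - t * inverse (y\<^sup>2) \<noteq> 0" by auto
    have "y - w * inverse y = y * (1 - w * inverse (y\<^sup>2))" for w
      using y by (simp add: field_simps power2_eq_square)
    from this[of t] this[of 1]
    have "(y - t * inverse y) / (y - inverse y) = (1 - t * inverse (y\<^sup>2)) / (1 - inverse (y\<^sup>2))"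
      using y by simp
    moreover have "1 - inverse (y\<^sup>2) = (y\<^sup>2 - 1) / y\<^sup>2"
      using y by (simp add: field_simps)
    ultimately show ?thesis unfolding one_minus_pm_def using nz y by simp
  qed
  have "letter_term t \<alpha> F K l ls a x = weight t F (K - {j}) x *
      (y ^ l * (1 - \<alpha> * y) * (1 / one_minus_pm t (y\<^sup>2) * ((y - t * inverse y) / (y - inverse y))) *
      ((\<Prod>u\<in>U. theta t y u) * (\<Prod>u\<in>U. (y - t * u) / (y - u))) *
      hl_sum t \<alpha> ls (insert (inverse y) U) (\<lambda>u. u))"
    unfolding letter_term_def y_def[symmetric] w p h by (simp add: mult_ac)
  also have "(\<Prod>u\<in>U. theta t y u) * (\<Prod>u\<in>U. (y - t * u) / (y - u)) =
      (\<Prod>u\<in>U. (1 - u * y) / (1 - t * u * y))"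
    unfolding prod.distrib[symmetric] by (intro prod.cong refl theta_first_letter t y U)
  finally show ?thesis
    unfolding q peel_kernel_def y_def[symmetric] power_add by (simp add: mult_ac)
qed

text \<open>
  With \<open>p\<close> the polynomial in the letter \<open>y\<^sup>-\<^sup>1\<close>, of degree at most \<open>l + 1\<close>, the product
  \<open>y\<^sup>l\<^sup>+\<^sup>1 p(y\<^sup>-\<^sup>1)\<close> is a polynomial in \<open>y\<close>, and one factor \<open>y\<close> is left over for the zero at \<open>0\<close>. This is
  where the decrease of the parts enters. A fixed letter \<open>c\<close> in \<open>U\<close> produces a factor \<open>1 - cy\<close>, hence the zero at \<open>c\<close>.
\<close>

lemma peel_kernel_holomorphic:
  assumes U: "finite U" "\<And>u. u \<in> U \<Longrightarrow> cmod u = 1"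
    and ls: "\<And>l'. l' \<in> set ls \<Longrightarrow> l' \<le> l" and \<rho>: "1 < \<rho>" "cmod t * \<rho>\<^sup>2 < 1"
  obtains E where "E holomorphic_on ball 0 \<rho>" "E 0 = 0"
    "\<And>y. y \<noteq> 0 \<Longrightarrow> inverse y \<notin> U \<Longrightarrow> E y = peel_kernel t \<alpha> l ls U y"
    "\<And>c. c \<in> U \<Longrightarrow> c \<in> {1, -1} \<Longrightarrow> E c = 0"
proof -
  obtain p where p: "degree p \<le> l + 1" "\<And>y. y \<notin> U \<Longrightarrow> hl_sum t \<alpha> ls (insert y U) (\<lambda>u. u) = poly p y"
    using hl_sum_insert_poly[OF U(1), of ls "l + 1" t \<alpha>] ls by (auto simp: less_Suc_eq_le)
  define E where "E = (\<lambda>y. y * (1 - \<alpha> * y) / (1 - t * y\<^sup>2) * (\<Prod>u\<in>U. (1 - u * y) / (1 - t * u * y)) *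
     (\<Sum>i\<le>l + 1. coeff p i * y ^ (l + 1 - i)))"
  have t\<rho>: "cmod t * \<rho> < 1"
  proof -
    have "cmod t * \<rho> \<le> cmod t * \<rho>\<^sup>2"
      using \<rho>(1) self_le_power[of \<rho> 2] by (intro mult_left_mono) auto
    then show ?thesis using \<rho>(2) by simp
  qed
  have "1 - t * y\<^sup>2 \<noteq> 0" if "y \<in> ball 0 \<rho>" for y
  proof (rule one_minus_neq_0)
    have "cmod t * (cmod y)\<^sup>2 \<le> cmod t * \<rho>\<^sup>2" using that by (intro mult_left_mono power_mono) auto
    then show "cmod (t * y\<^sup>2) < 1" using \<rho>(2) by (simp add: norm_mult norm_power)
  qed
  moreover have "1 - t * u * y \<noteq> 0" if "y \<in> ball 0 \<rho>" "u \<in> U" for y u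
  proof (rule one_minus_neq_0)
    have "cmod t * cmod y \<le> cmod t * \<rho>" using that by (intro mult_left_mono) auto
    then show "cmod (t * u * y) < 1" using t\<rho> U(2)[OF that(2)] by (simp add: norm_mult)
  qed
  ultimately have "E holomorphic_on ball 0 \<rho>"
    unfolding E_def by (intro holomorphic_intros) auto
  moreover have "E 0 = 0" by (simp add: E_def)
  moreover have "E y = peel_kernel t \<alpha> l ls U y" if y: "y \<noteq> 0" "inverse y \<notin> U" for y
  proof -
    have poly_p: "poly p z = (\<Sum>i\<le>l + 1. coeff p i * z ^ i)" for z
      unfolding poly_altdef using p(1) by (intro sum.mono_neutral_left) (auto simp: coeff_eq_0)
    have "y ^ (l + 1) * poly p (inverse y) = (\<Sum>i\<le>l + 1. coeff p i * y ^ (l + 1 - i))"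
      unfolding poly_p sum_distrib_left
    proof (intro sum.cong refl)
      fix i assume "i \<in> {..l + 1}"
      then have "y ^ (l + 1) = y ^ (l + 1 - i) * y ^ i" by (simp flip: power_add)
      then show "y ^ (l + 1) * (coeff p i * inverse y ^ i) = coeff p i * y ^ (l + 1 - i)"
        using y by (simp add: power_inverse)
    qed
    then show ?thesis
      unfolding peel_kernel_def E_def p(2)[OF y(2)] by (simp add: mult_ac)
  qed
  moreover have "E c = 0" if "c \<in> U" "c \<in> {1, -1}" for c
  proof -
    have "(\<Prod>u\<in>U. (1 - u * c) / (1 - t * u * c)) = 0"
      using U(1) that by (intro prod_zero bexI[of _ c]) auto
    then show ?thesis by (simp add: E_def)
  qed
  ultimately show thesis by (rule that)
qed

text \<open>
  On the circle of radius \<open>r > 1\<close> the letter \<open>y\<^sup>-\<^sup>1\<close> lies inside the unit disc, away from the letters in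
  \<open>U\<close>, so the bound on the sum over orderings that comes from its polynomial form applies. To state
  this, \<open>y\<^sup>-\<^sup>1\<close> is given the index \<open>Var j\<close> with \<open>j \<notin> K\<close>.
\<close>

lemma peel_kernel_bounded:
  assumes F: "F \<subseteq> {1, -1}" "finite K" and r: "1 < r" "cmod t * r\<^sup>2 < 1"
  obtains C where "\<And>x y. generic K x \<Longrightarrow> cmod y = r \<Longrightarrow>
    cmod (peel_kernel t \<alpha> l ls (letter_val x ` letters F K) y) \<le> C"
proof -
  let ?J = "letters F K"
  have finF: "finite F" using F finite_subset by auto
  have finJ: "finite ?J" using finF F by simp
  obtain j where j: "j \<notin> K" using ex_new_if_finite[OF infinite_UNIV_nat F(2)] by blast
  then have jJ: "Var j \<notin> ?J" by (auto simp: letters_def)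
  obtain Q where Q: "polyf (insert (Var j) ?J) Q"
    "\<And>z. inj_on z (insert (Var j) ?J) \<Longrightarrow> (\<forall>a\<in>insert (Var j) ?J. cmod (z a) \<le> 1) \<Longrightarrow>
      hl_sum t \<alpha> ls (insert (Var j) ?J) z = Q z"
    using hl_sum_polyf[of "insert (Var j) ?J" 1 t \<alpha> ls] finJ by auto
  obtain C2 where C2: "\<And>z. (\<forall>a\<in>insert (Var j) ?J. cmod (z a) \<le> 1) \<Longrightarrow> cmod (Q z) \<le> C2"
    using polyf_bounded[OF Q(1), of 1] by blast
  have tr: "cmod t * r < 1"
  proof -
    have "cmod t * r \<le> cmod t * r\<^sup>2" using r(1) self_le_power[of r 2] by (intro mult_left_mono) auto
    then show ?thesis using r(2) by simp
  qed
  let ?C = "r ^ (l + 2) * (1 + cmod \<alpha> * r) / (1 - cmod t * r\<^sup>2) * ((1 + r) / (1 - cmod t * r)) ^ card ?J * C2"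
  have "cmod (peel_kernel t \<alpha> l ls (letter_val x ` ?J) y) \<le> ?C" if x: "generic K x" and y: "cmod y = r" for x y
  proof -
    let ?U = "letter_val x ` ?J"
    note v = generic_letters[OF x F(1)]
    have cardU: "card ?U = card ?J" by (rule card_image[OF v(1)])
    have U: "cmod u = 1" if "u \<in> ?U" for u using v(2) that by auto
    have iy: "cmod (inverse y) < 1" using y r by (simp add: norm_inverse inverse_less_1_iff)
    have iyU: "inverse y \<notin> ?U" using U iy by force
    have H: "cmod (hl_sum t \<alpha> ls (insert (inverse y) ?U) (\<lambda>u. u)) \<le> C2"
    proof -
      let ?z = "(letter_val x)(Var j := inverse y)"
      have im: "?z ` insert (Var j) ?J = insert (inverse y) ?U" using jJ by auto
      have inj: "inj_on ?z (insert (Var j) ?J)"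
      proof (subst inj_on_insert, intro conjI)
        show "inj_on ?z ?J" using v(1) jJ by (simp add: inj_on_def)
        show "?z (Var j) \<notin> ?z ` (?J - {Var j})" using iyU jJ by (simp add: image_iff)
      qed
      have b: "\<forall>a\<in>insert (Var j) ?J. cmod (?z a) \<le> 1" using iy v(2) jJ by auto
      show ?thesis
        using hl_sum_image[OF inj, of t \<alpha> ls] Q(2)[OF inj b] C2[OF b] unfolding im by simp
    qed
    have P: "cmod (\<Prod>u\<in>?U. (1 - u * y) / (1 - t * u * y)) \<le> ((1 + r) / (1 - cmod t * r)) ^ card ?J"
      unfolding cardU[symmetric]
    proof (rule norm_prod_bound)
      fix u assume u: "u \<in> ?U"
      have "cmod (1 - u * y) \<le> 1 + r" using norm_triangle_ineq4[of 1 "u * y"] U[OF u] y by (simp add: norm_mult)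
      moreover have "1 - cmod t * r \<le> cmod (1 - t * u * y)"
        using norm_triangle_ineq2[of 1 "t * u * y"] U[OF u] y by (simp add: norm_mult)
      ultimately show "cmod ((1 - u * y) / (1 - t * u * y)) \<le> (1 + r) / (1 - cmod t * r)"
        unfolding norm_divide using tr r by (intro frac_le) auto
    qed
    have N: "cmod (y ^ (l + 2) * (1 - \<alpha> * y) / (1 - t * y\<^sup>2)) \<le> r ^ (l + 2) * (1 + cmod \<alpha> * r) / (1 - cmod t * r\<^sup>2)"
    proof -
      have "cmod (1 - \<alpha> * y) \<le> 1 + cmod \<alpha> * r" using norm_triangle_ineq4[of 1 "\<alpha> * y"] y by (simp add: norm_mult)
      then have "cmod (y ^ (l + 2) * (1 - \<alpha> * y)) \<le> r ^ (l + 2) * (1 + cmod \<alpha> * r)"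
        using r y by (auto simp: norm_mult norm_power simp del: power_Suc intro!: mult_left_mono)
      moreover have "1 - cmod t * r\<^sup>2 \<le> cmod (1 - t * y\<^sup>2)"
        using norm_triangle_ineq2[of 1 "t * y\<^sup>2"] y by (simp add: norm_mult norm_power)
      ultimately show ?thesis unfolding norm_divide using r
        by (intro frac_le) (auto intro!: mult_nonneg_nonneg add_nonneg_nonneg)
    qed
    show ?thesis
      unfolding peel_kernel_def norm_mult[of _ "hl_sum _ _ _ _ _"] norm_mult[of _ "prod _ _"]
      using r tr by (intro mult_mono N P H) (auto intro!: divide_nonneg_nonneg mult_nonneg_nonneg)
  qed
  then show thesis by (rule that)
qed

text \<open>
  The terms with first letter \<open>x\<^sub>j\<close> and \<open>x\<^sub>j\<^sup>-\<^sup>1\<close> must stay together: each alone has poles at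
  \<open>x\<^sub>j = \<plusminus>1\<close> and is in general not integrable.
\<close>

definition pair_term :: "complex \<Rightarrow> complex \<Rightarrow> complex set \<Rightarrow> nat set \<Rightarrow> nat \<Rightarrow> nat list \<Rightarrow> nat \<Rightarrow> (nat \<Rightarrow> complex) \<Rightarrow> complex" where
  "pair_term t \<alpha> F K l ls j x = letter_term t \<alpha> F K l ls (Var j) x + letter_term t \<alpha> F K l ls (Inv j) x"

lemma pair_term_eq:
  assumes "cmod t < 1" "F \<subseteq> {1, -1}" "finite K" "j \<in> K" "generic K x"
  defines "U \<equiv> letter_val x ` letters F (K - {j})"
  shows "pair_term t \<alpha> F K l ls j x = weight t F (K - {j}) x *
    (peel_kernel t \<alpha> l ls U (x j) / ((x j)\<^sup>2 - 1) +
     peel_kernel t \<alpha> l ls U (inverse (x j)) / ((inverse (x j))\<^sup>2 - 1))"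
  unfolding pair_term_def U_def
  using letter_term_variable[OF assms(1-5), of "Var j"] letter_term_variable[OF assms(1-5), of "Inv j"]
  by (simp add: distrib_left)

lemma letter_term_measurable:
  "a \<in> letters F K \<Longrightarrow> letter_term t \<alpha> F K l ls a \<in> borel_measurable (torus_measure K)"
  unfolding letter_term_def
  by (intro borel_measurable_times weight_measurable hl_sum_measurable letter_val_measurable
        borel_measurable_prod borel_measurable_divide borel_measurable_diff borel_measurable_power
        borel_measurable_const) auto

lemma pair_term_measurable:
  "j \<in> K \<Longrightarrow> pair_term t \<alpha> F K l ls j \<in> borel_measurable (torus_measure K)"
  unfolding pair_term_def by (intro borel_measurable_add letter_term_measurable) (auto simp: letters_def)

lemma radius_exists:
  assumes "cmod t < 1"
  obtains r \<rho> where "1 < r" "r < \<rho>" "cmod t * \<rho>\<^sup>2 < 1" "cmod t * r\<^sup>2 < 1"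
proof -
  \<comment> \<open>Any \<open>\<rho>\<^sup>2\<close> strictly between \<open>1\<close> and \<open>1 / \<bar>t\<bar>\<close> will do, and \<open>2 / (1 + \<bar>t\<bar>)\<close> makes sense for \<open>t = 0\<close> too.\<close>
  define \<rho> where "\<rho> = sqrt (2 / (1 + cmod t))"
  have p: "0 < 1 + cmod t" using norm_ge_zero[of t] by linarith
  have "1 < 2 / (1 + cmod t)" using assms p by (simp add: field_simps)
  then have 1: "1 < \<rho>" by (simp add: \<rho>_def)
  have "\<rho>\<^sup>2 = 2 / (1 + cmod t)" using p by (simp add: \<rho>_def)
  moreover have "cmod t * (2 / (1 + cmod t)) < 1" using assms p by (simp add: divide_less_eq)
  ultimately have 2: "cmod t * \<rho>\<^sup>2 < 1" by simp
  have "((1 + \<rho>) / 2)\<^sup>2 \<le> \<rho>\<^sup>2" using 1 by (intro power_mono) auto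
  then have "cmod t * ((1 + \<rho>) / 2)\<^sup>2 \<le> cmod t * \<rho>\<^sup>2" by (intro mult_left_mono) auto
  then have 3: "cmod t * ((1 + \<rho>) / 2)\<^sup>2 < 1" using 2 by linarith
  show thesis by (rule that[of "(1 + \<rho>) / 2" \<rho>]) (use 1 2 3 in auto)
qed

lemma pair_term_integrable:
  assumes t: "cmod t < 1" and F: "F \<subseteq> {1, -1}" and K: "finite K" "j \<in> K"
    and ls: "\<And>l'. l' \<in> set ls \<Longrightarrow> l' \<le> l"
  shows "integrable (torus_measure K) (pair_term t \<alpha> F K l ls j)"
proof -
  let ?K = "K - {j}"
  have finF: "finite F" using F finite_subset by auto
  obtain r \<rho> where r: "1 < r" "r < \<rho>" "cmod t * \<rho>\<^sup>2 < 1" "cmod t * r\<^sup>2 < 1"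
    using radius_exists[OF t] .
  obtain C1 where C1: "\<And>x. (\<forall>i\<in>?K. cmod (x i) = 1) \<Longrightarrow> cmod (weight t F ?K x) \<le> C1"
    using weight_bounded[OF t F] by blast
  have finK: "finite ?K" using K by simp
  obtain C where C: "\<And>x y. generic ?K x \<Longrightarrow> cmod y = r \<Longrightarrow>
    cmod (peel_kernel t \<alpha> l ls (letter_val x ` letters F ?K) y) \<le> C"
    using peel_kernel_bounded[OF F finK r(1) r(4), of \<alpha> l ls] by blast
  show ?thesis
  proof (rule integrable_torusI[OF K(1) pair_term_measurable[OF K(2)]])
    fix x assume x: "generic K x"
    have x': "generic ?K x" by (rule generic_subset[OF x]) auto
    let ?U = "letter_val x ` letters F ?K"
    note v = generic_letters[OF x F]
    have sub: "letters F ?K \<subseteq> letters F K" by (auto simp: letters_def)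
    have U: "finite ?U" "\<And>u. u \<in> ?U \<Longrightarrow> cmod u = 1" using finF K v(2) sub by auto
    have y: "cmod (x j) = 1" "(x j)\<^sup>2 \<noteq> 1" using x K by (auto simp: generic_def power2_eq_1_iff)
    have y0: "x j \<noteq> 0" using y by auto
    have nU: "x j \<notin> ?U" "inverse (x j) \<notin> ?U"
    proof -
      have "Var j \<in> letters F K" "Inv j \<in> letters F K" "Var j \<notin> letters F ?K" "Inv j \<notin> letters F ?K"
        using K by (auto simp: letters_def)
      then have "letter_val x (Var j) \<notin> ?U" "letter_val x (Inv j) \<notin> ?U"
        using inj_on_image_mem_iff[OF v(1) _ sub] by blast+
      then show "x j \<notin> ?U" "inverse (x j) \<notin> ?U" by simp_all
    qed
    have \<rho>1: "1 < \<rho>" using r by simp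
    obtain E where E: "E holomorphic_on ball 0 \<rho>" "E 0 = 0"
      "\<And>y. y \<noteq> 0 \<Longrightarrow> inverse y \<notin> ?U \<Longrightarrow> E y = peel_kernel t \<alpha> l ls ?U y"
      "\<And>c. c \<in> ?U \<Longrightarrow> c \<in> {1, -1} \<Longrightarrow> E c = 0"
      by (rule peel_kernel_holomorphic[where ls = ls and \<alpha> = \<alpha>, OF U ls \<rho>1 r(3)], assumption, assumption)
         (rule that)
    have EC: "cmod (E y) \<le> C" if "cmod y = r" for y
    proof -
      have "inverse y \<notin> ?U" "y \<noteq> 0" using U(2)[of "inverse y"] that r by (auto simp: norm_inverse)
      then show ?thesis using E(3)[of y] C[OF x' that] by simp
    qed
    have "cmod (E (x j) / ((x j)\<^sup>2 - 1) + E (inverse (x j)) / ((inverse (x j))\<^sup>2 - 1))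
        \<le> C * (2 * (2 + r) / (r\<^sup>2 - 1) + 1)"
      by (rule symmetrized_bound[OF E(1) r(1,2) EC y])
    moreover have "cmod (weight t F ?K x) \<le> C1" using C1 x' by (auto simp: generic_def)
    ultimately have "cmod (weight t F ?K x * (E (x j) / ((x j)\<^sup>2 - 1) + E (inverse (x j)) / ((inverse (x j))\<^sup>2 - 1)))
        \<le> C1 * (C * (2 * (2 + r) / (r\<^sup>2 - 1) + 1))"
      unfolding norm_mult by (intro mult_mono') auto
    then show "cmod (pair_term t \<alpha> F K l ls j x) \<le> C1 * (C * (2 * (2 + r) / (r\<^sup>2 - 1) + 1))"
      unfolding pair_term_eq[OF t F K x] using E(3)[of "x j"] E(3)[of "inverse (x j)"] nU y0 by simp
  qed
qed

text \<open>
  At \<open>y = c\<close> the remaining factors \<open>(1 - x\<^sub>ic)(1 - c/x\<^sub>i) / \<dots>\<close> of the numerator are \<open>\<theta>(x\<^sub>i, c)\<close>, so the letter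
  \<open>c\<close> takes the place of the pair \<open>y, y\<^sup>-\<^sup>1\<close> as a fixed letter.
\<close>

lemma weight_peel_kernel_at_sign:
  assumes F: "F \<subseteq> {1, -1}" and K: "finite K" and x: "generic K x" and c: "c \<in> {1, -1} - F"
  shows "weight t F K x * peel_kernel t \<alpha> l ls (letter_val x ` letters F K) c =
    c ^ l * (1 - \<alpha> * c) / (1 - t) * (\<Prod>f\<in>F. (1 - f * c) / (1 - t * f * c)) *
    hl_integrand t \<alpha> (insert c F) K ls x"
proof -
  have finF: "finite F" using F finite_subset by auto
  have cc: "c\<^sup>2 = 1" "inverse c = c" using c by auto
  note v = generic_letters[OF x F]
  have "insert c F \<subseteq> {1, -1}" using F c by auto
  note v' = generic_letters(1)[OF x this]
  have h: "hl_sum t \<alpha> ls (insert (inverse c) (letter_val x ` letters F K)) (\<lambda>u. u) =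
      hl_sum t \<alpha> ls (letters (insert c F) K) (letter_val x)"
    using hl_sum_image[OF v', of t \<alpha> ls] by (simp add: cc letters_insert_Fix)
  have p: "(\<Prod>u\<in>letter_val x ` letters F K. (1 - u * c) / (1 - t * u * c)) =
      (\<Prod>f\<in>F. (1 - f * c) / (1 - t * f * c)) * (\<Prod>i\<in>K. theta t (x i) c)"
    by (simp add: prod.reindex[OF v(1)] prod_letters[OF finF K] theta_def one_minus_pm_def mult_ac)
  have l2: "c ^ (l + 2) = c ^ l" by (simp only: power_add cc) simp
  show ?thesis
    unfolding peel_kernel_def h hl_integrand_def p l2 using c
    by (simp add: weight_insert[OF K finF] cc(1) mult_ac)
qed

lemma generic_update:
  assumes "generic (K - {j}) x" "cmod y = 1" "y \<noteq> 1" "y \<noteq> -1"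
    "\<And>i. i \<in> K - {j} \<Longrightarrow> y \<noteq> x i \<and> y \<noteq> inverse (x i)"
  shows "generic K (x(j := y))"
proof -
  have "x i \<noteq> inverse y" if "i \<in> K - {j}" for i using assms(5)[OF that] by auto
  then show ?thesis using assms unfolding generic_def by auto
qed

lemma pair_term_integral:
  assumes t: "cmod t < 1" and F: "F \<subseteq> {1, -1}" and K: "finite K" "j \<in> K"
    and ls: "\<And>l'. l' \<in> set ls \<Longrightarrow> l' \<le> l"
  shows "(\<integral>x. pair_term t \<alpha> F K l ls j x \<partial>torus_measure K) =
    (\<Sum>c\<in>{1, -1} - F. c ^ l * (1 - \<alpha> * c) / (2 * (1 - t)) * (\<Prod>f\<in>F. (1 - f * c) / (1 - t * f * c)) *
      (\<integral>x. hl_integrand t \<alpha> (insert c F) (K - {j}) ls x \<partial>torus_measure (K - {j})))"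
proof -
  let ?K = "K - {j}"
  let ?co = "\<lambda>c. c ^ l * (1 - \<alpha> * c) / (2 * (1 - t)) * (\<Prod>f\<in>F. (1 - f * c) / (1 - t * f * c))"
  have finF: "finite F" using F finite_subset by auto
  have iK: "insert j ?K = K" using K by auto
  have finK: "finite ?K" using K by simp
  obtain r \<rho> where r: "1 < r" "r < \<rho>" "cmod t * \<rho>\<^sup>2 < 1" using radius_exists[OF t] .
  have \<rho>1: "1 < \<rho>" using r by simp
  have int: "integrable (torus_measure ?K) (hl_integrand t \<alpha> (insert c F) ?K ls)" if "c \<in> {1, -1} - F" for c
    by (rule hl_integrand_integrable[OF t]) (use that F K in auto)
  have inner: "(\<integral>y. pair_term t \<alpha> F K l ls j (x(j := y)) \<partial>circle_measure) =
      (\<Sum>c\<in>{1, -1} - F. ?co c * hl_integrand t \<alpha> (insert c F) ?K ls x)"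
    if x: "generic ?K x" and sp: "x \<in> space (torus_measure ?K)" for x
  proof -
    let ?U = "letter_val x ` letters F ?K"
    note v = generic_letters[OF x F]
    have U: "finite ?U" "\<And>u. u \<in> ?U \<Longrightarrow> cmod u = 1" using finF K v(2) by auto
    obtain E where E: "E holomorphic_on ball 0 \<rho>" "E 0 = 0"
      "\<And>y. y \<noteq> 0 \<Longrightarrow> inverse y \<notin> ?U \<Longrightarrow> E y = peel_kernel t \<alpha> l ls ?U y"
      "\<And>c. c \<in> ?U \<Longrightarrow> c \<in> {1, -1} \<Longrightarrow> E c = 0"
      by (rule peel_kernel_holomorphic[where ls = ls and \<alpha> = \<alpha>, OF U ls \<rho>1 r(3)], assumption, assumption)
         (rule that)
    define w where "w = weight t F ?K x"
    have "(\<integral>y. pair_term t \<alpha> F K l ls j (x(j := y)) \<partial>circle_measure) = (w * E 1 + w * E (-1)) / 2"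
    proof (rule circle_integral_symmetrized[of "\<lambda>y. w * E y" \<rho> _ "x ` ?K \<union> inverse ` x ` ?K \<union> ?U \<union> inverse ` ?U"])
      show "(\<lambda>y. w * E y) holomorphic_on ball 0 \<rho>" by (intro holomorphic_intros E)
      show "1 < \<rho>" "w * E 0 = 0" using \<rho>1 E(2) by auto
      have "(\<lambda>y. x(j := y)) \<in> measurable circle_measure (torus_measure K)"
        by (rule measurable_fun_upd[where J = ?K]) (use K sp in auto)
      from measurable_compose[OF this pair_term_measurable[OF K(2)]]
      show "(\<lambda>y. pair_term t \<alpha> F K l ls j (x(j := y))) \<in> borel_measurable borel"
        by (simp add: measurable_cong_sets[OF sets_circle_measure refl])
      show "finite (x ` ?K \<union> inverse ` x ` ?K \<union> ?U \<union> inverse ` ?U)" using K U(1) by simp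
      fix y assume y: "cmod y = 1" "y \<notin> x ` ?K \<union> inverse ` x ` ?K \<union> ?U \<union> inverse ` ?U" "y\<^sup>2 \<noteq> 1"
      have y0: "y \<noteq> 0" and nU: "y \<notin> ?U" "inverse y \<notin> ?U"
        using y by (auto simp: image_iff) (metis inverse_inverse_eq)
      have g: "generic K (x(j := y))"
        by (rule generic_update[OF x y(1)]) (use y in auto)
      have lv: "letter_val (x(j := y)) a = letter_val x a" if "a \<in> letters F ?K" for a
        using that by (auto simp: letters_def split: if_splits)
      have "letter_val (x(j := y)) ` letters F ?K = ?U" using lv by (intro image_cong) auto
      moreover have "weight t F ?K (x(j := y)) = w" unfolding w_def by (rule weight_cong) auto
      ultimately show "pair_term t \<alpha> F K l ls j (x(j := y)) =
          w * E y / (y\<^sup>2 - 1) + w * E (inverse y) / ((inverse y)\<^sup>2 - 1)"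
        unfolding pair_term_eq[OF t F K g] using E(3)[of y] E(3)[of "inverse y"] y0 nU
        by (simp add: distrib_left)
    qed
    also have "\<dots> = (\<Sum>c\<in>{1, -1}. w * E c / 2)" by (simp add: add_divide_distrib)
    also have "\<dots> = (\<Sum>c\<in>{1, -1} - F. w * E c / 2)"
    proof (rule sum.mono_neutral_right)
      have "E c = 0" if "c \<in> F" for c
        by (rule E(4)) (use that F in \<open>force simp: letters_def\<close>)+
      then show "\<forall>c\<in>{1, -1} - ({1, -1} - F). w * E c / 2 = 0" by auto
    qed auto
    also have "\<dots> = (\<Sum>c\<in>{1, -1} - F. ?co c * hl_integrand t \<alpha> (insert c F) ?K ls x)"
    proof (intro sum.cong refl)
      fix c assume c: "c \<in> {1, -1} - F"
      have ne: "letter_val x a \<noteq> c" if "a \<in> letters F ?K" for a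
      proof
        assume "letter_val x a = c"
        moreover have "insert c F \<subseteq> {1, -1}" using F c by auto
        note v' = generic_letters(1)[OF x this]
        ultimately have "a = Fix c"
          using inj_onD[OF v', of a "Fix c"] that by (auto simp: letters_insert_Fix)
        then show False using that c by (auto simp: letters_def)
      qed
      have cc: "inverse c = c" using c by auto
      have "inverse c \<notin> ?U" unfolding cc using ne by blast
      moreover have "c \<noteq> 0" using c by auto
      ultimately have "inverse c \<notin> ?U" "c \<noteq> 0" .
      from E(3)[OF this(2,1)] weight_peel_kernel_at_sign[OF F finK x c, of t \<alpha> l ls]
      show "w * E c / 2 = ?co c * hl_integrand t \<alpha> (insert c F) ?K ls x"
        by (simp add: w_def)
    qed
    finally show ?thesis .
  qed
  have "(\<integral>x. pair_term t \<alpha> F K l ls j x \<partial>torus_measure K) =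
      (\<integral>x. (\<integral>y. pair_term t \<alpha> F K l ls j (x(j := y)) \<partial>circle_measure) \<partial>torus_measure ?K)"
    using product_sigma_finite.product_integral_insert[OF product_sigma_finite_circle finK, of j "pair_term t \<alpha> F K l ls j"]
      pair_term_integrable[OF t F K ls] unfolding iK by simp
  also have "\<dots> = (\<integral>x. (\<Sum>c\<in>{1, -1} - F. ?co c * hl_integrand t \<alpha> (insert c F) ?K ls x) \<partial>torus_measure ?K)"
  proof (rule integral_cong_AE)
    have "(\<lambda>p. (fst p)(j := snd p)) \<in> measurable (torus_measure ?K \<Otimes>\<^sub>M circle_measure) (torus_measure K)"
      by (rule measurable_fun_upd[where J = ?K]) (use K in auto)
    from measurable_compose[OF this pair_term_measurable[OF K(2)]]
    have "(\<lambda>(x, y). pair_term t \<alpha> F K l ls j (x(j := y))) \<in> borel_measurable (torus_measure ?K \<Otimes>\<^sub>M circle_measure)"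
      by (simp add: split_def)
    then show "(\<lambda>x. \<integral>y. pair_term t \<alpha> F K l ls j (x(j := y)) \<partial>circle_measure) \<in> borel_measurable (torus_measure ?K)"
      by (rule sigma_finite_measure.borel_measurable_lebesgue_integral
          [OF prob_space_imp_sigma_finite[OF prob_space_circle_measure]])
    show "(\<lambda>x. \<Sum>c\<in>{1, -1} - F. ?co c * hl_integrand t \<alpha> (insert c F) ?K ls x) \<in> borel_measurable (torus_measure ?K)"
      using int by (intro borel_measurable_sum borel_measurable_times borel_measurable_const borel_measurable_integrable) auto
    show "AE x in torus_measure ?K. (\<integral>y. pair_term t \<alpha> F K l ls j (x(j := y)) \<partial>circle_measure) =
        (\<Sum>c\<in>{1, -1} - F. ?co c * hl_integrand t \<alpha> (insert c F) ?K ls x)"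
      using AE_generic[OF finK] AE_space by eventually_elim (rule inner)
  qed
  also have "\<dots> = (\<Sum>c\<in>{1, -1} - F. ?co c * (\<integral>x. hl_integrand t \<alpha> (insert c F) ?K ls x \<partial>torus_measure ?K))"
    using int by (subst Bochner_Integration.integral_sum) auto
  finally show ?thesis .
qed

section \<open>The recursion and its solution\<close>

lemma letter_term_fixed:
  assumes t: "cmod t < 1" and F: "F \<subseteq> {1, -1}" and K: "finite K" and x: "generic K x" and c: "c \<in> F"
  shows "letter_term t \<alpha> F K l ls (Fix c) x = c ^ l * (1 - \<alpha> * c) * (\<Prod>f\<in>F - {c}. (c - t * f) / (c - f)) *
    hl_integrand t \<alpha> (F - {c}) K ls x"
proof -
  have finF: "finite F" using F finite_subset by auto
  have "weight t F K x = weight t (F - {c}) K x * (\<Prod>i\<in>K. theta t (x i) c)"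
    using weight_insert[OF K, of "F - {c}" c t x] finF c by (simp add: insert_absorb)
  moreover have "(\<Prod>i\<in>K. theta t (x i) c) *
      (\<Prod>i\<in>K. (c - t * x i) / (c - x i) * ((c - t * inverse (x i)) / (c - inverse (x i)))) = 1"
    unfolding prod.distrib[symmetric]
    by (intro prod.neutral ballI theta_fixed_letter) (use t x F c in \<open>auto simp: generic_def\<close>)
  moreover have "w * A * (g * (p * B) * h) = g * p * (w * h)" if "A * B = 1" for w A g p B h :: complex
  proof -
    have "w * A * (g * (p * B) * h) = (A * B) * (g * p * (w * h))" by (simp only: mult_ac)
    then show ?thesis using that by simp
  qed
  ultimately show ?thesis
    unfolding letter_term_def letters_remove_Fix hl_integrand_def
    using finF K by (simp add: prod_letters)
qed

lemma hl_integral_Cons: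
  assumes t: "cmod t < 1" and F: "F \<subseteq> {1, -1}" and K: "finite K"
    and ls: "\<And>l'. l' \<in> set ls \<Longrightarrow> l' \<le> l"
  shows "(\<integral>x. hl_integrand t \<alpha> F K (l # ls) x \<partial>torus_measure K) =
    (\<Sum>c\<in>F. c ^ l * (1 - \<alpha> * c) * (\<Prod>f\<in>F - {c}. (c - t * f) / (c - f)) *
      (\<integral>x. hl_integrand t \<alpha> (F - {c}) K ls x \<partial>torus_measure K)) +
    (\<Sum>j\<in>K. \<Sum>c\<in>{1, -1} - F. c ^ l * (1 - \<alpha> * c) / (2 * (1 - t)) * (\<Prod>f\<in>F. (1 - f * c) / (1 - t * f * c)) *
      (\<integral>x. hl_integrand t \<alpha> (insert c F) (K - {j}) ls x \<partial>torus_measure (K - {j})))"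
proof -
  have finF: "finite F" using F finite_subset by auto
  let ?co = "\<lambda>c. c ^ l * (1 - \<alpha> * c) * (\<Prod>f\<in>F - {c}. (c - t * f) / (c - f))"
  have int: "integrable (torus_measure K) (hl_integrand t \<alpha> (F - {c}) K ls)" for c
    by (rule hl_integrand_integrable[OF t _ K]) (use F in auto)
  have int2: "integrable (torus_measure K) (pair_term t \<alpha> F K l ls j)" if "j \<in> K" for j
    by (rule pair_term_integrable[OF t F K that ls])
  have intL: "integrable (torus_measure K) (\<lambda>x. \<Sum>c\<in>F. ?co c * hl_integrand t \<alpha> (F - {c}) K ls x)"
    by (intro Bochner_Integration.integrable_sum integrable_mult_right int)
  have intR: "integrable (torus_measure K) (\<lambda>x. \<Sum>j\<in>K. pair_term t \<alpha> F K l ls j x)"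
    by (intro Bochner_Integration.integrable_sum int2)
  have "(\<integral>x. hl_integrand t \<alpha> F K (l # ls) x \<partial>torus_measure K) =
     (\<integral>x. (\<Sum>c\<in>F. ?co c * hl_integrand t \<alpha> (F - {c}) K ls x) + (\<Sum>j\<in>K. pair_term t \<alpha> F K l ls j x) \<partial>torus_measure K)"
  proof (rule integral_cong_AE)
    show "hl_integrand t \<alpha> F K (l # ls) \<in> borel_measurable (torus_measure K)"
      by (intro borel_measurable_integrable hl_integrand_integrable[OF t F K])
    show "(\<lambda>x. (\<Sum>c\<in>F. ?co c * hl_integrand t \<alpha> (F - {c}) K ls x) + (\<Sum>j\<in>K. pair_term t \<alpha> F K l ls j x)) \<in> borel_measurable (torus_measure K)"
      by (intro borel_measurable_integrable Bochner_Integration.integrable_add intL intR)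
    show "AE x in torus_measure K. hl_integrand t \<alpha> F K (l # ls) x =
        (\<Sum>c\<in>F. ?co c * hl_integrand t \<alpha> (F - {c}) K ls x) + (\<Sum>j\<in>K. pair_term t \<alpha> F K l ls j x)"
      using AE_generic[OF K]
    proof eventually_elim
      case (elim x)
      have "hl_integrand t \<alpha> F K (l # ls) x = (\<Sum>a\<in>letters F K. letter_term t \<alpha> F K l ls a x)"
        unfolding hl_integrand_def letter_term_def hl_sum.simps by (rule sum_distrib_left)
      also have "\<dots> = (\<Sum>c\<in>F. letter_term t \<alpha> F K l ls (Fix c) x) + (\<Sum>j\<in>K. pair_term t \<alpha> F K l ls j x)"
        unfolding pair_term_def by (rule sum_letters[OF finF K])
      also have "(\<Sum>c\<in>F. letter_term t \<alpha> F K l ls (Fix c) x) = (\<Sum>c\<in>F. ?co c * hl_integrand t \<alpha> (F - {c}) K ls x)"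
        by (intro sum.cong refl letter_term_fixed[OF t F K elim])
      finally show ?case .
    qed
  qed
  also have "\<dots> = (\<Sum>c\<in>F. ?co c * (\<integral>x. hl_integrand t \<alpha> (F - {c}) K ls x \<partial>torus_measure K)) +
      (\<Sum>j\<in>K. \<integral>x. pair_term t \<alpha> F K l ls j x \<partial>torus_measure K)"
    using int int2 by (subst Bochner_Integration.integral_add[OF intL intR]) (simp add: Bochner_Integration.integral_sum)
  also have "(\<Sum>j\<in>K. \<integral>x. pair_term t \<alpha> F K l ls j x \<partial>torus_measure K) =
    (\<Sum>j\<in>K. \<Sum>c\<in>{1, -1} - F. c ^ l * (1 - \<alpha> * c) / (2 * (1 - t)) * (\<Prod>f\<in>F. (1 - f * c) / (1 - t * f * c)) *
      (\<integral>x. hl_integrand t \<alpha> (insert c F) (K - {j}) ls x \<partial>torus_measure (K - {j})))"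
    by (intro sum.cong refl pair_term_integral[OF t F K _ ls])
  finally show ?thesis .
qed

text \<open>
  The proportionality factor between the integrals for different \<open>F\<close>, read off from the recursion.
\<close>

definition torus_const :: "complex \<Rightarrow> complex set \<Rightarrow> complex" where
  "torus_const t F = (if F = {} then 1 / 2 else if F = {1, -1} then 1 + t else 1)"

text \<open>
  Write \<open>g\<^sub>l(c) = e + c o\<close> for \<open>c = \<plusminus>1\<close>. Each step of the recursion multiplies \<open>\<Prod>e\<close> and \<open>\<Prod>o\<close> by the
  \<open>e\<close> and \<open>o\<close> of the new part, so the solution is a multiple of \<open>\<Prod>e + (\<Prod>F) \<Prod>o\<close>, the products being over the parts.
  For even \<open>l\<close> one has \<open>e = 1, o = -\<alpha>\<close>, for odd \<open>l\<close> the other way round, which turns the products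
  into powers of \<open>-\<alpha>\<close>.
\<close>

lemma hl_integral_value:
  assumes t: "cmod t < 1"
  shows "F \<subseteq> {1, -1} \<Longrightarrow> finite K \<Longrightarrow> sorted_wrt (\<ge>) lam \<Longrightarrow> length lam = 2 * card K + card F \<Longrightarrow>
    (\<integral>x. hl_integrand t \<alpha> F K lam x \<partial>torus_measure K) =
    2 ^ card K * fact (card K) / (1 - t) ^ card K * torus_const t F *
    ((-\<alpha>) ^ length (filter odd lam) + \<Prod>F * (-\<alpha>) ^ length (filter even lam))"
proof (induction lam arbitrary: F K)
  case Nil
  have "finite F" using Nil.prems(1) finite_subset by auto
  then have "K = {}" "F = {}" using Nil by auto
  moreover have "(\<integral>x. 1 \<partial>torus_measure {}) = (1 :: complex)"
    using prob_space.prob_space[OF prob_space_torus[of "{}"]] by simp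
  ultimately show ?case
    by (simp add: hl_integrand_def[abs_def] weight_def torus_const_def)
next
  case (Cons l ls)
  define E O' where "E = (-\<alpha>) ^ length (filter odd ls)" and "O' = (-\<alpha>) ^ length (filter even ls)"
  define g where "g = (\<lambda>c::complex. c ^ l * (1 - \<alpha> * c))"
  define A where "A = (\<lambda>k. 2 ^ k * fact k / (1 - t) ^ k)"
  define I where "I = (\<lambda>F K. \<integral>x. hl_integrand t \<alpha> F K ls x \<partial>torus_measure K)"
  have t1: "1 - t \<noteq> 0" "1 + t \<noteq> 0"
    using one_minus_neq_0[OF t] one_minus_neq_0[of "-t"] t by auto
  have IH: "I F' K' = A (card K') * torus_const t F' * (E + \<Prod>F' * O')"
    if "F' \<subseteq> {1, -1}" "finite K'" "length ls = 2 * card K' + card F'" for F' K'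
    using Cons.IH[OF that(1,2) _ that(3)] Cons.prems(3) by (simp add: I_def A_def E_def O'_def)
  have A_Suc: "of_nat (Suc m) * A m / (1 - t) = A (Suc m) / 2" for m
    using t1 by (simp add: A_def field_simps)
  have parity: "(-\<alpha>) ^ length (filter odd (l # ls)) = (g 1 + g (-1)) / 2 * E"
    "(-\<alpha>) ^ length (filter even (l # ls)) = (g 1 - g (-1)) / 2 * O'"
    by (cases "even l"; simp add: E_def O'_def g_def)+
  have "F = {} \<or> F = {1} \<or> F = {-1} \<or> F = {1, -1}" using Cons.prems(1) by auto
  then have "\<exists>c\<in>{1, -1}. F = {} \<or> F = {c} \<or> F = {1, -1}" by auto
  then obtain c :: complex where c: "c \<in> {1, -1}" "F = {} \<or> F = {c} \<or> F = {1, -1}" by blast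
  have cm: "c \<noteq> -c" "{1, -1} - {c} = {-c}" "c * c = 1" using c by auto
  have rec: "(\<integral>x. hl_integrand t \<alpha> F K (l # ls) x \<partial>torus_measure K) =
    (\<Sum>c\<in>F. g c * (\<Prod>f\<in>F - {c}. (c - t * f) / (c - f)) * I (F - {c}) K) +
    (\<Sum>j\<in>K. \<Sum>c\<in>{1, -1} - F. g c / (2 * (1 - t)) * (\<Prod>f\<in>F. (1 - f * c) / (1 - t * f * c)) *
      I (insert c F) (K - {j}))"
    unfolding g_def I_def by (rule hl_integral_Cons) (use t Cons.prems in auto)
  have "(\<integral>x. hl_integrand t \<alpha> F K (l # ls) x \<partial>torus_measure K) =
    A (card K) * torus_const t F * ((g 1 + g (-1)) / 2 * E + \<Prod>F * ((g 1 - g (-1)) / 2 * O'))"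
    using c(2)
  proof (elim disjE)
    assume F: "F = {}"
    then obtain m where m: "card K = Suc m" using Cons.prems(4) by (cases "card K") auto
    have Ic: "I {c} (K - {j}) = A m * (E + c * O')" if "j \<in> K" "c \<in> {1, -1}" for j c
    proof -
      have "I {c} (K - {j}) = A (card (K - {j})) * torus_const t {c} * (E + \<Prod>{c} * O')"
        by (rule IH) (use that Cons.prems F m in auto)
      moreover have "card (K - {j}) = m" using m that Cons.prems(2) by simp
      moreover have "torus_const t {c} = 1"
        using that(2) by (auto simp: torus_const_def doubleton_eq_iff)
      ultimately show ?thesis by simp
    qed
    have "(\<integral>x. hl_integrand t \<alpha> F K (l # ls) x \<partial>torus_measure K) =
      (\<Sum>j\<in>K. \<Sum>c\<in>{1, -1}. g c / (2 * (1 - t)) * I {c} (K - {j}))"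
      using rec unfolding F by simp
    also have "\<dots> = (\<Sum>j\<in>K. \<Sum>c\<in>{1, -1}. g c / (2 * (1 - t)) * (A m * (E + c * O')))"
      by (intro sum.cong refl) (simp only: Ic)
    also have "\<dots> = (of_nat (Suc m) * A m / (1 - t)) * ((g 1 * (E + O') + g (-1) * (E - O')) / 2)"
    proof -
      have "N * (a / (2 * d) * (B * (E + 1 * O')) + b / (2 * d) * (B * (E + -1 * O'))) =
          N * B / d * ((a * (E + O') + b * (E - O')) / 2)" for N a b B d :: complex
        by (cases "d = 0") (simp_all add: field_simps)
      from this[of "of_nat (Suc m)" "g 1" "1 - t" "A m" "g (-1)"] show ?thesis
        unfolding sum_constant m by simp
    qed
    also have "\<dots> = A (card K) / 2 * ((g 1 * (E + O') + g (-1) * (E - O')) / 2)"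
      unfolding A_Suc m ..
    also have "\<dots> = A (card K) * torus_const t F * ((g 1 + g (-1)) / 2 * E + \<Prod>F * ((g 1 - g (-1)) / 2 * O'))"
      unfolding F by (simp add: torus_const_def field_simps)
    finally show ?thesis .
  next
    assume F: "F = {c}"
    have c1: "torus_const t {c} = 1" using c(1) by (auto simp: torus_const_def doubleton_eq_iff)
    have gc: "A (card K) * ((g 1 + g (-1)) / 2 * E + c * ((g 1 - g (-1)) / 2 * O')) =
        A (card K) / 2 * (g c * (E + O') + g (-c) * (E - O'))"
      using c(1) by (auto simp: field_simps)
    have I0: "I {} K = A (card K) / 2 * (E + O')"
      using IH[of "{}" K] Cons.prems F by (simp add: torus_const_def)
    have mu: "(1 - c * - c) / (1 - t * c * - c) = 2 / (1 + t)"
      using cm(3) by (simp add: mult.assoc)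
    have "(\<integral>x. hl_integrand t \<alpha> F K (l # ls) x \<partial>torus_measure K) =
      g c * (A (card K) / 2 * (E + O')) +
      (\<Sum>j\<in>K. g (-c) / (2 * (1 - t)) * (2 / (1 + t)) * I {-c, c} (K - {j}))"
    proof -
      have "(\<Sum>d\<in>{c}. g d * (\<Prod>f\<in>{c} - {d}. (d - t * f) / (d - f)) * I ({c} - {d}) K) =
          g c * (A (card K) / 2 * (E + O'))"
        by (simp add: I0)
      moreover have "(\<Sum>d\<in>{1, -1} - {c}. g d / (2 * (1 - t)) * (\<Prod>f\<in>{c}. (1 - f * d) / (1 - t * f * d)) *
          I (insert d {c}) (K - {j})) = g (-c) / (2 * (1 - t)) * (2 / (1 + t)) * I {-c, c} (K - {j})" for j
        unfolding cm(2) mu[symmetric] by simp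
      ultimately show ?thesis unfolding rec[unfolded F] F by simp
    qed
    also have "(\<Sum>j\<in>K. g (-c) / (2 * (1 - t)) * (2 / (1 + t)) * I {-c, c} (K - {j})) =
       A (card K) / 2 * (g (-c) * (E - O'))"
    \<comment> \<open>Without variables there is no second contribution; the right-hand side vanishes too, since then no parts are left.\<close>
    proof (cases "card K")
      case 0
      then have "ls = []" using Cons.prems(4) F by simp
      then show ?thesis using 0 Cons.prems(2) by (simp add: E_def O'_def)
    next
      case (Suc m)
      have "I {-c, c} (K - {j}) = A m * (1 + t) * (E - O')" if "j \<in> K" for j
      proof -
        have cc: "{-c, c} = {1, -1}" using c(1) by auto
        have "I {1, -1} (K - {j}) = A (card (K - {j})) * torus_const t {1, -1} * (E + \<Prod>{1, -1} * O')"
          by (rule IH) (use that Cons.prems F Suc in auto)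
        moreover have "card (K - {j}) = m" using Suc that Cons.prems(2) by simp
        ultimately show ?thesis by (simp add: torus_const_def cc)
      qed
      then have "(\<Sum>j\<in>K. g (-c) / (2 * (1 - t)) * (2 / (1 + t)) * I {-c, c} (K - {j})) =
        (\<Sum>j\<in>K. g (-c) / (2 * (1 - t)) * (2 / (1 + t)) * (A m * (1 + t) * (E - O')))"
        by (simp cong: sum.cong)
      also have "\<dots> = (of_nat (Suc m) * A m / (1 - t)) * (g (-c) * (E - O'))"
        using t1 Suc by (simp add: divide_simps)
      also have "\<dots> = A (card K) / 2 * (g (-c) * (E - O'))"
        unfolding A_Suc Suc ..
      finally show ?thesis .
    qed
    also have "g c * (A (card K) / 2 * (E + O')) + A (card K) / 2 * (g (-c) * (E - O')) =
        A (card K) / 2 * (g c * (E + O') + g (-c) * (E - O'))"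
      by (simp add: algebra_simps)
    also note gc[symmetric]
    finally show ?thesis unfolding F c1 by simp
  next
    assume F: "F = {1, -1}"
    have "I {c} K = A (card K) * (E + c * O')" if "c \<in> {1, -1}" for c
    proof -
      have "torus_const t {c} = 1"
        using that by (auto simp: torus_const_def doubleton_eq_iff)
      then show ?thesis using IH[of "{c}" K] that Cons.prems F by auto
    qed
    moreover have "{1, -1} - {1} = {-1::complex}" "{1, -1} - {-1} = {1::complex}" by auto
    ultimately have "(\<integral>x. hl_integrand t \<alpha> F K (l # ls) x \<partial>torus_measure K) =
      g 1 * ((1 + t) / 2) * (A (card K) * (E - O')) + g (-1) * ((-1 - t) / (-2)) * (A (card K) * (E + O'))"
      unfolding F rec[unfolded F] by simp
    also have "(-1 - t) / (-2) = (1 + t) / 2" by (simp add: field_simps)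
    finally show ?thesis using F by (simp add: torus_const_def field_simps)
  qed
  then show ?case unfolding parity A_def .
qed

section \<open>The Koornwinder integral\<close>

lemma koornwinder_density_weight:
  assumes "s\<^sup>2 = t"
  shows "koornwinder_density k x t (-t) s (-s) t = 1 / (2 ^ k * fact k) * weight t {1, -1} {..<k} x"
proof -
  have "one_minus_pm 1 (y\<^sup>2) / (one_minus_pm t y * one_minus_pm (-t) y * one_minus_pm s y * one_minus_pm (-s) y) =
     (\<Prod>f\<in>{1, -1}. theta t y f) / one_minus_pm t (y\<^sup>2)" for y
  proof -
    have "one_minus_pm 1 (y\<^sup>2) = one_minus_pm 1 y * one_minus_pm (-1) y"
      "one_minus_pm s y * one_minus_pm (-s) y = one_minus_pm t (y\<^sup>2)"
      unfolding one_minus_pm_def assms[symmetric] power_inverse[symmetric]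
      by (simp_all add: power2_eq_square algebra_simps)
    then show ?thesis by (simp add: theta_def mult.assoc)
  qed
  moreover have "{(i, j). i < j \<and> j < k} = {(i, j). i \<in> {..<k} \<and> j \<in> {..<k} \<and> i < j}" by auto
  ultimately show ?thesis
    unfolding koornwinder_density_def weight_def by simp
qed

lemma pm_args_letters:
  assumes x: "generic {..<k} x"
  shows "inj_on (pm_args k x) {..<2 * (k + 1)}"
    and "pm_args k x ` {..<2 * (k + 1)} = letter_val x ` letters {1, -1} {..<k}"
proof -
  show im: "pm_args k x ` {..<2 * (k + 1)} = letter_val x ` letters {1, -1} {..<k}"
  proof (intro equalityI subsetI)
    fix u assume "u \<in> pm_args k x ` {..<2 * (k + 1)}"
    then obtain m where m: "m < 2 * (k + 1)" "u = pm_args k x m" by auto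
    then consider "m < 2 * k" | "m = 2 * k" | "m = 2 * k + 1" by fastforce
    then show "u \<in> letter_val x ` letters {1, -1} {..<k}"
    proof cases
      case 1
      then have "letter_val x (if even m then Var (m div 2) else Inv (m div 2)) = u"
        "(if even m then Var (m div 2) else Inv (m div 2)) \<in> letters {1, -1} {..<k}"
        by (auto simp: m pm_args_def letters_def)
      then show ?thesis by blast
    next
      case 2
      then have "u = letter_val x (Fix 1)" by (simp add: m pm_args_def)
      then show ?thesis by (auto simp: letters_def simp del: letter_val.simps)
    next
      case 3
      then have "u = letter_val x (Fix (-1))" by (simp add: m pm_args_def)
      then show ?thesis by (auto simp: letters_def simp del: letter_val.simps)
    qed
  next
    fix u assume "u \<in> letter_val x ` letters {1, -1} {..<k}"
    then consider i where "i < k" "u = x i" | i where "i < k" "u = inverse (x i)" | "u = 1" | "u = -1"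
      by (auto simp: letters_def)
    then show "u \<in> pm_args k x ` {..<2 * (k + 1)}"
    proof cases
      case 1
      then show ?thesis by (intro image_eqI[of _ _ "2 * i"]) (auto simp: pm_args_def)
    next
      case 2
      then show ?thesis by (intro image_eqI[of _ _ "2 * i + 1"]) (auto simp: pm_args_def)
    next
      case 3
      then show ?thesis by (intro image_eqI[of _ _ "2 * k"]) (auto simp: pm_args_def)
    next
      case 4
      then show ?thesis by (intro image_eqI[of _ _ "2 * k + 1"]) (auto simp: pm_args_def)
    qed
  qed
  have "card (letter_val x ` letters {1, -1} {..<k}) = card (letters {1, -1} {..<k})"
    by (rule card_image, rule generic_letters(1)[OF x]) simp
  also have "\<dots> = 2 * (k + 1)" using sum_letters[of "{1, -1}" "{..<k}" "\<lambda>_. 1::nat"] by simp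
  finally show "inj_on (pm_args k x) {..<2 * (k + 1)}"
    by (intro eq_card_imp_inj_on) (simp, simp only: im card_lessThan)
qed

theorem theorem4p5:
  fixes n :: nat and lam :: "nat list" and t s \<alpha> :: complex
  assumes "cmod t < 1"
    and "s\<^sup>2 = t"
    and "n \<ge> 1"
    and "is_partition lam"
    and "length lam = 2 * n"
  shows "(1 - \<alpha>\<^sup>2) /
           torus_integral (n - 1) (\<lambda>x. koornwinder_density (n - 1) x t (-t) s (-s) t) *
         torus_integral (n - 1) (\<lambda>x.
           hall_littlewood lam t (pm_args (n - 1) x) *
           koornwinder_density (n - 1) x t (-t) s (-s) t *
           (\<Prod>i<n - 1. one_minus_pm \<alpha> (x i)))
       = phi (2 * n) t / (v_part lam t * (1 - t) ^ (2 * n)) *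
         ((-\<alpha>) ^ length (filter odd lam) - (-\<alpha>) ^ length (filter even lam))"
proof -
  define k where "k = n - 1"
  have N: "2 * n = 2 * (k + 1)" "length lam = 2 * (k + 1)" using assms(3,5) by (simp_all add: k_def)
  let ?K = "{..<k}" and ?F = "{1, -1} :: complex set"
  let ?J = "letters ?F ?K"
  let ?M = "torus_measure ?K"
  define c0 where "c0 = (1 + t) / (1 - t) ^ k"
  define q where "q = (2 ^ k * fact k :: complex)"
  have q: "q \<noteq> 0" by (simp add: q_def)
  have t1: "1 - t \<noteq> 0" "1 + t \<noteq> 0"
    using one_minus_neq_0[OF assms(1)] one_minus_neq_0[of "-t"] assms(1) by auto
  then have c0: "c0 \<noteq> 0" by (simp add: c0_def)
  have cardJ: "card ?J = 2 * (k + 1)" using sum_letters[of ?F ?K "\<lambda>_. 1::nat"] by simp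
  have integral_value: "(\<integral>x. hl_integrand t a ?F ?K mu x \<partial>?M) =
      q * c0 * ((-a) ^ length (filter odd mu) - (-a) ^ length (filter even mu))"
    if "sorted_wrt (\<ge>) mu" "length mu = 2 * (k + 1)" for a mu
    using hl_integral_value[OF assms(1), of ?F ?K mu a] that
    by (simp add: torus_const_def c0_def q_def)
  \<comment> \<open>The normalising integral, from the all-zero partition with \<open>\<alpha> = 0\<close>; here \<open>(-\<alpha>)\<^sup>2\<^sup>n = 0\<close> because \<open>n > 0\<close>.\<close>
  have Z: "t_fact t (2 * n) * torus_integral k (\<lambda>x. koornwinder_density k x t (-t) s (-s) t) = c0"
  proof -
    have "(\<integral>x. hl_integrand t 0 ?F ?K (replicate (2 * (k + 1)) 0) x \<partial>?M) =
        (\<integral>x. q * t_fact t (2 * n) * koornwinder_density k x t (-t) s (-s) t \<partial>?M)"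
    proof (rule integral_cong_AE)
      show "hl_integrand t 0 ?F ?K (replicate (2 * (k + 1)) 0) \<in> borel_measurable ?M"
        by (intro borel_measurable_integrable hl_integrand_integrable[OF assms(1)]) auto
      show "(\<lambda>x. q * t_fact t (2 * n) * koornwinder_density k x t (-t) s (-s) t) \<in> borel_measurable ?M"
        unfolding koornwinder_density_weight[OF assms(2)]
        by (intro borel_measurable_times borel_measurable_const weight_measurable)
      show "AE x in ?M. hl_integrand t 0 ?F ?K (replicate (2 * (k + 1)) 0) x =
          q * t_fact t (2 * n) * koornwinder_density k x t (-t) s (-s) t"
        using AE_generic[OF finite_lessThan]
      proof eventually_elim
        case (elim x)
        note v = generic_letters[OF elim, of ?F, simplified]
        have "letter_val x a \<noteq> 0" if "a \<in> ?J" for a using v(2)[OF that] by auto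
        then have "hl_sum t 0 (replicate (card ?J) 0) ?J (letter_val x) = t_fact t (card ?J)"
          using t1 by (intro hl_sum_replicate_0 v(1)) auto
        then show ?case
          unfolding hl_integrand_def koornwinder_density_weight[OF assms(2)] cardJ N(1)
          using q by (simp add: q_def)
      qed
    qed
    moreover have "filter odd (replicate m (0::nat)) = []" for m by (induction m) auto
    moreover have "filter even (replicate m (0::nat)) = replicate m 0" for m by (induction m) auto
    moreover have "sorted_wrt (\<ge>) (replicate m (0::nat))" for m by (induction m) auto
    ultimately have "q * c0 = q * (t_fact t (2 * n) * torus_integral k (\<lambda>x. koornwinder_density k x t (-t) s (-s) t))"
      using integral_value[of "replicate (2 * (k + 1)) 0" 0] by (auto simp: torus_integral_def mult.assoc)
    then show ?thesis using q by simp
  qed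
  have I: "(1 - \<alpha>\<^sup>2) * torus_integral k (\<lambda>x. hall_littlewood lam t (pm_args k x) *
      koornwinder_density k x t (-t) s (-s) t * (\<Prod>i<k. one_minus_pm \<alpha> (x i))) =
      c0 / v_part lam t * ((-\<alpha>) ^ length (filter odd lam) - (-\<alpha>) ^ length (filter even lam))"
  proof -
    have meas: "(\<lambda>x. pm_args k x m) \<in> borel_measurable ?M" for m
      unfolding pm_args_def
      by (cases "m < 2 * k"; cases "even m"; cases "m = 2 * k")
         (auto intro!: measurable_torus_component borel_measurable_inverse)
    have "(1 - \<alpha>\<^sup>2) * torus_integral k (\<lambda>x. hall_littlewood lam t (pm_args k x) *
      koornwinder_density k x t (-t) s (-s) t * (\<Prod>i<k. one_minus_pm \<alpha> (x i))) =
      (\<integral>x. (1 - \<alpha>\<^sup>2) * (hall_littlewood lam t (pm_args k x) *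
      koornwinder_density k x t (-t) s (-s) t * (\<Prod>i<k. one_minus_pm \<alpha> (x i))) \<partial>?M)"
      unfolding torus_integral_def by simp
    also have "\<dots> = (\<integral>x. 1 / (q * v_part lam t) * hl_integrand t \<alpha> ?F ?K lam x \<partial>?M)"
    proof (rule integral_cong_AE)
      show "(\<lambda>x. (1 - \<alpha>\<^sup>2) * (hall_littlewood lam t (pm_args k x) *
        koornwinder_density k x t (-t) s (-s) t * (\<Prod>i<k. one_minus_pm \<alpha> (x i)))) \<in> borel_measurable ?M"
        unfolding koornwinder_density_weight[OF assms(2)]
        by (intro borel_measurable_times borel_measurable_const weight_measurable
            hall_littlewood_measurable meas borel_measurable_prod one_minus_pm_measurable measurable_torus_component)
      show "(\<lambda>x. 1 / (q * v_part lam t) * hl_integrand t \<alpha> ?F ?K lam x) \<in> borel_measurable ?M"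
        by (intro borel_measurable_times borel_measurable_const borel_measurable_integrable
            hl_integrand_integrable[OF assms(1)]) auto
      show "AE x in ?M. (1 - \<alpha>\<^sup>2) * (hall_littlewood lam t (pm_args k x) *
        koornwinder_density k x t (-t) s (-s) t * (\<Prod>i<k. one_minus_pm \<alpha> (x i))) =
        1 / (q * v_part lam t) * hl_integrand t \<alpha> ?F ?K lam x"
        using AE_generic[OF finite_lessThan]
      proof eventually_elim
        case (elim x)
        note v = generic_letters(1)[OF elim, of ?F, simplified]
        note pm = pm_args_letters[OF elim]
        have "(\<Prod>m<length lam. 1 - \<alpha> * pm_args k x m) = (\<Prod>u\<in>pm_args k x ` {..<2 * (k + 1)}. 1 - \<alpha> * u)"
          unfolding N(2) by (simp only: prod.reindex[OF pm(1)] o_def)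
        also have "\<dots> = (1 - \<alpha>) * (1 + \<alpha>) * (\<Prod>i<k. one_minus_pm \<alpha> (x i))"
          unfolding pm(2) prod.reindex[OF v] by (simp add: prod_letters one_minus_pm_def)
        also have "(1 - \<alpha>) * (1 + \<alpha>) = 1 - \<alpha>\<^sup>2" by (simp add: power2_eq_square algebra_simps)
        finally have p: "(\<Prod>m<length lam. 1 - \<alpha> * pm_args k x m) = (1 - \<alpha>\<^sup>2) * (\<Prod>i<k. one_minus_pm \<alpha> (x i))" .
        have "hall_littlewood lam t (pm_args k x) = hl_expr lam t (pm_args k x)"
          by (rule hall_littlewood_distinct) (use pm(1) N(2) in simp)
        moreover have "hl_sum t \<alpha> lam {..<length lam} (pm_args k x) = hl_sum t \<alpha> lam ?J (letter_val x)"
          unfolding N(2) hl_sum_image[OF pm(1), symmetric] hl_sum_image[OF v, symmetric] pm(2) ..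
        ultimately have h: "hall_littlewood lam t (pm_args k x) * ((1 - \<alpha>\<^sup>2) * (\<Prod>i<k. one_minus_pm \<alpha> (x i))) =
            hl_sum t \<alpha> lam ?J (letter_val x) / v_part lam t"
          using hl_expr_times_prod[of lam t "pm_args k x" \<alpha>] p by simp
        have "(1 - \<alpha>\<^sup>2) * (hall_littlewood lam t (pm_args k x) *
          koornwinder_density k x t (-t) s (-s) t * (\<Prod>i<k. one_minus_pm \<alpha> (x i))) =
          (hall_littlewood lam t (pm_args k x) * ((1 - \<alpha>\<^sup>2) * (\<Prod>i<k. one_minus_pm \<alpha> (x i)))) *
          koornwinder_density k x t (-t) s (-s) t" by (simp only: mult_ac)
        then show ?case
          unfolding h koornwinder_density_weight[OF assms(2)] hl_integrand_def by (simp add: q_def mult_ac)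
      qed
    qed
    also have "\<dots> = 1 / (q * v_part lam t) * (\<integral>x. hl_integrand t \<alpha> ?F ?K lam x \<partial>?M)" by simp
    also have "\<dots> = c0 / v_part lam t * ((-\<alpha>) ^ length (filter odd lam) - (-\<alpha>) ^ length (filter even lam))"
      using integral_value[of lam \<alpha>] assms(4) N(2) q by (simp add: is_partition_def)
    finally show ?thesis .
  qed
  have fact: "phi (2 * n) t / (1 - t) ^ (2 * n) = t_fact t (2 * n)"
    by (simp add: phi_def t_fact_def t_num_def prod_dividef)
  define Z' where "Z' = torus_integral k (\<lambda>x. koornwinder_density k x t (-t) s (-s) t)"
  have "t_fact t (2 * n) = c0 / Z'" "Z' \<noteq> 0"
    using Z c0 by (auto simp: Z'_def field_simps)
  have r: "c0 / v_part lam t * X / Z' = phi (2 * n) t / (v_part lam t * (1 - t) ^ (2 * n)) * X" for X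
  proof -
    have "c0 / v_part lam t * X / Z' = c0 / Z' / v_part lam t * X" by simp
    also have "c0 / Z' = phi (2 * n) t / (1 - t) ^ (2 * n)" unfolding fact \<open>t_fact t (2 * n) = c0 / Z'\<close> ..
    finally show ?thesis by (simp add: mult.commute)
  qed
  have "(1 - \<alpha>\<^sup>2) / Z' * J = ((1 - \<alpha>\<^sup>2) * J) / Z'" for J by simp
  then show ?thesis unfolding k_def[symmetric] Z'_def[symmetric] using I r by simp
qed

end
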